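(* Let $\beta\in(0,2]$, $L>0$ and $f_0\in\mathcal H^\beta(L)$, and assume $\|f_0\|_\infty\le F$ for some $F>0$. Let $(X,Y)=((X_i,Y_i))_{1\le i\le n}\sim P_{f_0}^n$ be data from the random design regression model. Let $0\le\alpha\le\beta$ and let $\Pi$ be the overparameterized shallow ReLU network prior of width $N_\alpha$ with scaling $\sigma_n$ specified below and weights having density with $p$-exponential tails with parameters $0<p\le1$ and $q$. Let $\rho\in(0,1)$, let $T_F:f\mapsto -F\vee(f\wedge F)$ and let $\Pi_\rho^F[\,\cdot\mid X,Y]=\Pi_\rho[\,\cdot\mid X,Y]\circ T_F^{-1}$ be the clipped $\rho$-posterior. Let $\varepsilon_n^\ast=n^{-\frac{\beta}{1+2\beta}}$ and $\varepsilon_n^+=n^{-2/5}$. Then, for a large enough constant $M'>0$ (depending on $F$), as $n\to\infty$, $$E_{f_0}\Pi_\rho^F\big[\{f:\ \|f-f_0\|_{2,P_X}\ge M'\varepsilon_n\}\mid X,Y\big]\to0,$$ where $\varepsilon_n$ is given by: (i) (oracle $\sigma_n$) for $\sigma_n=N_\alpha^{-\frac2{2+p}}N_\beta^{\frac p{2+p}-\beta}(\log n)^{-\frac2{q(2+p)}}$, $$\varepsilon_n=\varepsilon_n^\ast\,(N_\alpha N_\beta)^{\frac p{2+p}}(\log n)^{\frac p{q(2+p)}};$$ (ii) (non-oracle $\sigma_n$) for $\sigma_n=\varepsilon_n^+/N_\alpha$, $$\varepsilon_n=\varepsilon_n^\ast\; n^{\,p\left(\frac{1-\beta}{2+4\beta}+\frac15+\frac1{2+4\alpha}\right)}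 .$$
   Context: Random design regression: one observes i.i.d. pairs $(X_i,Y_i)\in[0,1]\times\mathbb R$, $Y_i=f(X_i)+\xi_i$, with $X_i$ i.i.d. from a distribution $P_X$ on $[0,1]$ and, independently, $\xi_i$ i.i.d. $\mathcal N(0,1)$. $P_f$ is the law of one pair, $P_f^n$ that of the sample, $E_{f_0}$ the expectation under $P_{f_0}^n$. For a prior $\Pi$ on $f$, the $\rho$-posterior is $\Pi_\rho[B\mid X,Y]=\int_Be^{\rho\ell_n(f)}d\Pi(f)/\int e^{\rho\ell_n(f)}d\Pi(f)$ with $\ell_n(f)=-\frac12\sum_{i=1}^n(Y_i-f(X_i))^2$. The loss is $\|f-f_0\|_{2,P_X}^2=\int(f-f_0)^2dP_X$. Hölder ball: for $\beta\in(0,2]$, with $\underline\beta\in\{0,1\}$ the largest integer strictly smaller than $\beta$, $\mathcal H^\beta(L)$ is the set of $f:[0,1]\to\mathbb R$ with $\max_{0\le i\le\underline\beta}\|D^if\|_\infty+\sup_{x\ne y}|D^{\underline\beta}f(x)-D^{\underline\beta}f(y)|/|x-y|^{\beta-\underline\beta}\le L$. For $s\ge0$, $N_s=2^{m_s}$ where $m_s$ is the closest integer solution to $2^{m_s}=n^{1/(2s+1)}$ (so $N_s\asymp n^{1/(2s+1)}$). Shallow ReLU network prior: $f(x)=\sum_{k=0}^{N_\alpha-1}w_k(x-a_k)_++b$, with $(u)_+=\max(u,0)$, $a_k=k/N_\alpha$ deterministic, $w_k=\sigma_n\zeta_k$ with $\zeta_k$ i.i.d. of density $h$, $\sigma_n>0$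 deterministic, and $b\sim\pi_b$ independent of the weights, where $\pi_b$ has a symmetric, continuous, strictly positive density on $\mathbb R$. $p$-exponential tails with parameters $(p,q)$: $h$ is symmetric about $0$; $h(t)\ge c_0e^{-c_1t^p}$ for $t\ge0$, some $c_0,c_1>0$; and for $q\in(0,p]$ and some $d_0,d_1,M_0>0$, $\int_x^\infty h(t)dt\le d_0e^{-d_1x^q}$ for $x\ge M_0$. *)

theory Defs
  imports "HOL-Probability.Probability"
begin

section \<open>Hoelder balls on the unit interval\<close>

text \<open>The largest integer strictly smaller than \<open>\<beta>\<close>, for \<open>\<beta> > 0\<close>.\<close>

definition strict_floor :: "real \<Rightarrow> nat" where
  "strict_floor \<beta> = nat (\<lceil>\<beta>\<rceil> - 1)"

text \<open>\<open>D i\<close> is the \<open>i\<close>-th derivative of \<open>f\<close> on \<open>[0,1]\<close>, one-sided at the end points, so that the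
  values of \<open>f\<close> outside \<open>[0,1]\<close> are irrelevant. The suprema are taken in the extended reals: the
  supremum of an unbounded set of reals would be unspecified.\<close>

definition holder_ball :: "real \<Rightarrow> real \<Rightarrow> (real \<Rightarrow> real) set" where
  "holder_ball \<beta> L = {f. \<exists>D :: nat \<Rightarrow> real \<Rightarrow> real.
     (\<forall>x\<in>{0..1}. D 0 x = f x) \<and>
     (\<forall>i<strict_floor \<beta>. \<forall>x\<in>{0..1}.
        (D i has_real_derivative D (Suc i) x) (at x within {0..1})) \<and>
     (MAX i\<in>{..strict_floor \<beta>}. SUP x\<in>{0..1}. ereal \<bar>D i x\<bar>)
       + (SUP (x, y)\<in>{(x, y). x \<in> {0..1} \<and> y \<in> {0..1} \<and> x \<noteq> y}.
            ereal (\<bar>D (strict_floor \<beta>) x - D (strict_floor \<beta>) y\<bar>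
                     / \<bar>x - y\<bar> powr (\<beta> - real (strict_floor \<beta>))))
       \<le> ereal L}"


section \<open>Random design regression\<close>

definition design_distribution :: "real measure \<Rightarrow> bool" where
  "design_distribution PX \<longleftrightarrow>
     prob_space PX \<and> sets PX = sets (restrict_space borel {0..1})"

definition pair_law :: "real measure \<Rightarrow> (real \<Rightarrow> real) \<Rightarrow> (real \<times> real) measure" where
  "pair_law PX f =
     distr (PX \<Otimes>\<^sub>M density lborel (\<lambda>t. ennreal (std_normal_density t)))
       (PX \<Otimes>\<^sub>M borel) (\<lambda>(x, \<xi>). (x, f x + \<xi>))"

definition sample_law ::
  "real measure \<Rightarrow> (real \<Rightarrow> real) \<Rightarrow> nat \<Rightarrow> (nat \<Rightarrow> real \<times> real) measure" where
  "sample_law PX f n = (\<Pi>\<^sub>M i\<in>{1..n}. pair_law PX f)"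

definition log_lik :: "nat \<Rightarrow> (nat \<Rightarrow> real \<times> real) \<Rightarrow> (real \<Rightarrow> real) \<Rightarrow> real" where
  "log_lik n XY f = - (1/2) * (\<Sum>i=1..n. (snd (XY i) - f (fst (XY i)))\<^sup>2)"

definition L2_dist :: "real measure \<Rightarrow> (real \<Rightarrow> real) \<Rightarrow> (real \<Rightarrow> real) \<Rightarrow> real" where
  "L2_dist PX f g = sqrt (\<integral>x. (f x - g x)\<^sup>2 \<partial>PX)"


section \<open>Priors and fractional posteriors on continuous functions\<close>

text \<open>The space of continuous functions on \<open>[0,1]\<close> (extended by \<open>undefined\<close>), with the
  \<open>\<sigma>\<close>-algebra generated by the point evaluations; this is the Borel \<open>\<sigma>\<close>-algebra of the
  supremum norm.\<close>

definition C01 :: "(real \<Rightarrow> real) measure" where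
  "C01 = restrict_space (\<Pi>\<^sub>M x\<in>{0..1}. borel) {f. continuous_on {0..1} f}"

definition rho_posterior ::
  "real \<Rightarrow> (real \<Rightarrow> real) measure \<Rightarrow> nat \<Rightarrow> (nat \<Rightarrow> real \<times> real) \<Rightarrow> (real \<Rightarrow> real) set \<Rightarrow> real" where
  "rho_posterior \<rho> Q n XY B =
     (LINT f:B|Q. exp (\<rho> * log_lik n XY f)) / (LINT f|Q. exp (\<rho> * log_lik n XY f))"

definition clip :: "real \<Rightarrow> (real \<Rightarrow> real) \<Rightarrow> real \<Rightarrow> real" where
  "clip F f = (\<lambda>x\<in>{0..1}. max (- F) (min (f x) F))"

definition clipped_rho_posterior ::
  "real \<Rightarrow> real \<Rightarrow> (real \<Rightarrow> real) measure \<Rightarrow> nat \<Rightarrow> (nat \<Rightarrow> real \<times> real) \<Rightarrow>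
     (real \<Rightarrow> real) set \<Rightarrow> real" where
  "clipped_rho_posterior \<rho> F Q n XY B = rho_posterior \<rho> Q n XY (clip F -` B \<inter> space Q)"


section \<open>Shallow ReLU network priors\<close>

definition prob_density :: "(real \<Rightarrow> real) \<Rightarrow> bool" where
  "prob_density h \<longleftrightarrow> h \<in> borel_measurable borel \<and> (\<forall>t. 0 \<le> h t) \<and>
     prob_space (density lborel (\<lambda>t. ennreal (h t)))"

definition p_exponential_tails :: "real \<Rightarrow> real \<Rightarrow> (real \<Rightarrow> real) \<Rightarrow> bool" where
  "p_exponential_tails p q h \<longleftrightarrow>
     0 < q \<and> q \<le> p \<and>
     (\<forall>t. h (- t) = h t) \<and>
     (\<exists>c\<^sub>0>0. \<exists>c\<^sub>1>0. \<forall>t\<ge>0. h t \<ge> c\<^sub>0 * exp (- c\<^sub>1 * t powr p)) \<and>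
     (\<exists>d\<^sub>0>0. \<exists>d\<^sub>1>0. \<exists>M\<^sub>0>0. \<forall>x\<ge>M\<^sub>0.
        (LINT t:{x..}|lborel. h t) \<le> d\<^sub>0 * exp (- d\<^sub>1 * x powr q))"

text \<open>\<open>width s n = 2 ^ m\<close> with \<open>m\<close> the integer closest to the real solution of
  \<open>2 powr m = n powr (1 / (2 * s + 1))\<close>.\<close>

definition width :: "real \<Rightarrow> nat \<Rightarrow> nat" where
  "width s n = 2 ^ nat (round (log 2 (real n) / (2 * s + 1)))"

definition relu_net :: "nat \<Rightarrow> (nat \<Rightarrow> real) \<Rightarrow> real \<Rightarrow> real \<Rightarrow> real" where
  "relu_net N w b = (\<lambda>x\<in>{0..1}. (\<Sum>k<N. w k * max (x - real k / real N) 0) + b)"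

text \<open>\<open>\<zeta>\<^sub>k\<close> i.i.d. with density \<open>h\<close>, independent of the bias \<open>b\<close> with density \<open>g\<close>.\<close>

definition relu_prior ::
  "nat \<Rightarrow> real \<Rightarrow> (real \<Rightarrow> real) \<Rightarrow> (real \<Rightarrow> real) \<Rightarrow> (real \<Rightarrow> real) measure" where
  "relu_prior N \<sigma> h g =
     distr ((\<Pi>\<^sub>M k\<in>{..<N}. density lborel (\<lambda>t. ennreal (h t)))
              \<Otimes>\<^sub>M density lborel (\<lambda>t. ennreal (g t)))
       C01 (\<lambda>(\<zeta>, b). relu_net N (\<lambda>k. \<sigma> * \<zeta> k) b)"


section \<open>Scalings and rates\<close>

definition eps_star :: "real \<Rightarrow> nat \<Rightarrow> real" where
  "eps_star \<beta> n = real n powr (- \<beta> / (1 + 2 * \<beta>))"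

definition eps_plus :: "nat \<Rightarrow> real" where
  "eps_plus n = real n powr (- 2 / 5)"

definition sigma_oracle :: "real \<Rightarrow> real \<Rightarrow> real \<Rightarrow> real \<Rightarrow> nat \<Rightarrow> real" where
  "sigma_oracle \<alpha> \<beta> p q n =
     real (width \<alpha> n) powr (- 2 / (2 + p)) * real (width \<beta> n) powr (p / (2 + p) - \<beta>)
       * ln (real n) powr (- 2 / (q * (2 + p)))"

definition eps_oracle :: "real \<Rightarrow> real \<Rightarrow> real \<Rightarrow> real \<Rightarrow> nat \<Rightarrow> real" where
  "eps_oracle \<alpha> \<beta> p q n =
     eps_star \<beta> n * (real (width \<alpha> n) * real (width \<beta> n)) powr (p / (2 + p))
       * ln (real n) powr (p / (q * (2 + p)))"

definition sigma_nonoracle :: "real \<Rightarrow> nat \<Rightarrow> real" where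
  "sigma_nonoracle \<alpha> n = eps_plus n / real (width \<alpha> n)"

definition eps_nonoracle :: "real \<Rightarrow> real \<Rightarrow> real \<Rightarrow> nat \<Rightarrow> real" where
  "eps_nonoracle \<alpha> \<beta> p n =
     eps_star \<beta> n
       * real n powr (p * ((1 - \<beta>) / (2 + 4 * \<beta>) + 1 / 5 + 1 / (2 + 4 * \<alpha>)))"

end

theory Submission
  imports Defs "HOL-Real_Asymp.Real_Asymp"
begin

text \<open>
  Put \<open>Z = exp (\<rho> (\<ell>\<^sub>n(f) - \<ell>\<^sub>n(f\<^sub>0)))\<close>. The posterior mass of a set is a ratio of integrals of
  \<open>Z\<close>. Under the true law \<open>E Z\<close> decays like \<open>exp (- c n \<parallel>T\<^sub>F f - f\<^sub>0\<parallel>\<^sup>2)\<close>, because clipping only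
  brings \<open>f\<close> closer to \<open>f\<^sub>0\<close>, and Jensen bounds the inverse of the denominator by the integral of
  \<open>1/Z\<close> over a uniform \<open>\<epsilon>\<close>-neighbourhood of \<open>f\<^sub>0\<close>, on which \<open>E (1/Z) \<le> exp (C n \<epsilon>\<^sup>2)\<close>. Since a
  posterior mass is at most its square root, Cauchy-Schwarz decouples the two factors, so neither
  tests nor sieves are needed: contraction follows from the prior mass of that neighbourhood.

  For the prior mass, \<open>f\<^sub>0\<close> is interpolated linearly on the coarse grid of width \<open>N\<^sub>\<beta>\<close>, a subgrid of the
  knots since both widths are powers of two. Up to the initial slope, the nonzero weights are slope changes of size
  \<open>N\<^sub>\<beta>\<^bsup>1 - \<beta>\<^esup>\<close>, and cost \<open>N\<^sub>\<beta> (N\<^sub>\<beta>\<^bsup>1 - \<beta>\<^esup> / \<sigma>\<^sub>n)\<^sup>p\<close> in the exponent; all other weights must only be at most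
  \<open>\<epsilon> / N\<^sub>\<alpha>\<close>, which the upper tail makes likely once \<open>\<epsilon> / (N\<^sub>\<alpha> \<sigma>\<^sub>n)\<close> exceeds a multiple of
  \<open>(log n)\<^bsup>1 / q\<^esup>\<close>. Both choices of \<open>\<sigma>\<^sub>n\<close> make the first cost of order \<open>n \<epsilon>\<^sup>2\<close>.
\<close>

section \<open>Gaussian likelihood ratios\<close>

text \<open>Completing the square: the tilted standard normal density is a constant multiple of the
  normal density with mean \<open>a\<close>, and the latter integrates to 1.\<close>

lemma nn_integral_std_normal_exp:
  "(\<integral>\<^sup>+t. ennreal (exp (a * t)) \<partial>density lborel (\<lambda>t. ennreal (std_normal_density t)))
     = ennreal (exp (a\<^sup>2 / 2))"
proof -
  have "emeasure (density lborel (\<lambda>t. ennreal (normal_density a 1 t))) (space lborel) = 1"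
    using prob_space.emeasure_space_1[OF prob_space_normal_density[of 1 a]] by simp
  then have *: "(\<integral>\<^sup>+t. ennreal (normal_density a 1 t) \<partial>lborel) = 1"
    by (simp add: emeasure_density)
  have "std_normal_density t * exp (a * t) = exp (a\<^sup>2 / 2) * normal_density a 1 t" for t
    by (simp add: normal_density_def power2_diff add_divide_distrib diff_divide_distrib
        flip: exp_add)
  then have "(\<integral>\<^sup>+t. ennreal (exp (a * t)) \<partial>density lborel (\<lambda>t. ennreal (std_normal_density t)))
     = (\<integral>\<^sup>+t. ennreal (exp (a\<^sup>2 / 2)) * ennreal (normal_density a 1 t) \<partial>lborel)"
    by (simp add: nn_integral_density flip: ennreal_mult)
  also have "\<dots> = ennreal (exp (a\<^sup>2 / 2))"
    by (simp add: nn_integral_cmult *)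
  finally show ?thesis .
qed

lemma design_space: "design_distribution PX \<Longrightarrow> space PX = {0..1}"
  unfolding design_distribution_def
  by (auto dest: sets_eq_imp_space_eq simp: space_restrict_space)

lemma design_prob_space: "design_distribution PX \<Longrightarrow> prob_space PX"
  by (simp add: design_distribution_def)

lemma prob_space_std_normal: "prob_space (density lborel (\<lambda>t. ennreal (std_normal_density t)))"
  by (rule prob_space_normal_density) simp

lemma pair_law_measurable:
  assumes [measurable]: "f \<in> borel_measurable PX"
  shows "(\<lambda>(x, \<xi>). (x, f x + \<xi>))
     \<in> measurable (PX \<Otimes>\<^sub>M density lborel (\<lambda>t. ennreal (std_normal_density t))) (PX \<Otimes>\<^sub>M borel)"
  by measurable

lemma prob_space_pair_law:
  assumes "design_distribution PX" and [measurable]: "f \<in> borel_measurable PX"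
  shows "prob_space (pair_law PX f)"
proof -
  interpret X: prob_space PX using assms(1) by (rule design_prob_space)
  interpret N: prob_space "density lborel (\<lambda>t. ennreal (std_normal_density t))"
    by (rule prob_space_std_normal)
  interpret XN: pair_prob_space PX "density lborel (\<lambda>t. ennreal (std_normal_density t))" ..
  show ?thesis unfolding pair_law_def by (intro XN.prob_space_distr pair_law_measurable assms)
qed

lemma sets_pair_law [measurable_cong]: "sets (pair_law PX f) = sets (PX \<Otimes>\<^sub>M borel)"
  by (simp add: pair_law_def)

text \<open>Integrating out the noise by the Gaussian exponential moment leaves only the squared
  distance of \<open>f\<close> and \<open>f\<^sub>0\<close>. The sign of
  \<open>s\<^sup>2 - s\<close> decides the use: \<open>s = \<rho>\<close> in (0, 1) makes the
  exponent negative and serves the numerator of the posterior, \<open>s = - \<rho>\<close> makes it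
  positive and serves the denominator.\<close>

lemma nn_integral_pair_law_tilt:
  assumes PX: "design_distribution PX"
    and [measurable]: "f\<^sub>0 \<in> borel_measurable PX" "f \<in> borel_measurable PX"
  shows "(\<integral>\<^sup>+z. ennreal (exp (s / 2 * ((snd z - f\<^sub>0 (fst z))\<^sup>2 - (snd z - f (fst z))\<^sup>2))) \<partial>pair_law PX f\<^sub>0)
     = (\<integral>\<^sup>+x. ennreal (exp ((s\<^sup>2 - s) / 2 * (f x - f\<^sub>0 x)\<^sup>2)) \<partial>PX)"
proof -
  let ?N = "density lborel (\<lambda>t. ennreal (std_normal_density t))"
  interpret N: prob_space ?N by (rule prob_space_std_normal)
  have "(\<integral>\<^sup>+z. ennreal (exp (s / 2 * ((snd z - f\<^sub>0 (fst z))\<^sup>2 - (snd z - f (fst z))\<^sup>2))) \<partial>pair_law PX f\<^sub>0)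
     = (\<integral>\<^sup>+(x, \<xi>). ennreal (exp (s / 2 * (\<xi>\<^sup>2 - (f\<^sub>0 x + \<xi> - f x)\<^sup>2))) \<partial>(PX \<Otimes>\<^sub>M ?N))"
    unfolding pair_law_def by (subst nn_integral_distr) (auto intro!: nn_integral_cong)
  also have "\<dots> = (\<integral>\<^sup>+x. \<integral>\<^sup>+\<xi>. ennreal (exp (s / 2 * (\<xi>\<^sup>2 - (f\<^sub>0 x + \<xi> - f x)\<^sup>2))) \<partial>?N \<partial>PX)"
    by (subst N.nn_integral_fst[symmetric]) auto
  also have "\<dots> = (\<integral>\<^sup>+x. \<integral>\<^sup>+\<xi>. ennreal (exp (- s / 2 * (f x - f\<^sub>0 x)\<^sup>2)) *
      ennreal (exp (s * (f x - f\<^sub>0 x) * \<xi>)) \<partial>?N \<partial>PX)"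
    by (intro nn_integral_cong, subst ennreal_mult[symmetric])
       (auto simp: power2_eq_square field_simps simp flip: exp_add)
  also have "\<dots> = (\<integral>\<^sup>+x. ennreal (exp (- s / 2 * (f x - f\<^sub>0 x)\<^sup>2)) *
      ennreal (exp ((s * (f x - f\<^sub>0 x))\<^sup>2 / 2)) \<partial>PX)"
    by (intro nn_integral_cong, subst nn_integral_cmult) (auto simp: nn_integral_std_normal_exp)
  also have "- s / 2 * d\<^sup>2 + (s * d)\<^sup>2 / 2 = (s\<^sup>2 - s) / 2 * d\<^sup>2" for d :: real
    by (simp add: power_mult_distrib algebra_simps diff_divide_distrib)
  then have "(\<integral>\<^sup>+x. ennreal (exp (- s / 2 * (f x - f\<^sub>0 x)\<^sup>2)) *
      ennreal (exp ((s * (f x - f\<^sub>0 x))\<^sup>2 / 2)) \<partial>PX)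
      = (\<integral>\<^sup>+x. ennreal (exp ((s\<^sup>2 - s) / 2 * (f x - f\<^sub>0 x)\<^sup>2)) \<partial>PX)"
    by (simp only: exp_add[symmetric] ennreal_mult[symmetric] exp_ge_zero)
  finally show ?thesis .
qed

lemma sets_sample_law:
  "sets (sample_law PX f n) = sets (\<Pi>\<^sub>M i\<in>{1..n}. PX \<Otimes>\<^sub>M borel)"
  unfolding sample_law_def by (intro sets_PiM_cong) (auto simp: sets_pair_law)

text \<open>The log-likelihood difference is a sum over independent pairs, so the expectation of its
  exponential is a power of the one-pair formula.\<close>

lemma nn_integral_sample_law_tilt:
  assumes PX: "design_distribution PX"
    and [measurable]: "f\<^sub>0 \<in> borel_measurable PX" "f \<in> borel_measurable PX"
  shows "(\<integral>\<^sup>+XY. ennreal (exp (s * (log_lik n XY f - log_lik n XY f\<^sub>0))) \<partial>sample_law PX f\<^sub>0 n)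
     = (\<integral>\<^sup>+x. ennreal (exp ((s\<^sup>2 - s) / 2 * (f x - f\<^sub>0 x)\<^sup>2)) \<partial>PX) ^ n"
proof -
  interpret Z: product_sigma_finite "\<lambda>_. pair_law PX f\<^sub>0"
    by (intro product_sigma_finite.intro prob_space_imp_sigma_finite prob_space_pair_law assms)
  define t where "t z = s / 2 * ((snd z - f\<^sub>0 (fst z))\<^sup>2 - (snd z - f (fst z))\<^sup>2)" for z
  have [measurable]: "t \<in> borel_measurable (PX \<Otimes>\<^sub>M borel)"
    unfolding t_def by measurable
  have "s * (log_lik n XY f - log_lik n XY f\<^sub>0) = (\<Sum>i=1..n. t (XY i))" for XY
    unfolding log_lik_def t_def sum_distrib_left[symmetric] sum_subtractf
    by (simp add: algebra_simps)
  then have "(\<integral>\<^sup>+XY. ennreal (exp (s * (log_lik n XY f - log_lik n XY f\<^sub>0))) \<partial>sample_law PX f\<^sub>0 n)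
    = (\<integral>\<^sup>+XY. (\<Prod>i=1..n. ennreal (exp (t (XY i)))) \<partial>(\<Pi>\<^sub>M i\<in>{1..n}. pair_law PX f\<^sub>0))"
    by (simp add: sample_law_def exp_sum prod_ennreal)
  also have "\<dots> = (\<Prod>i=1..n. \<integral>\<^sup>+z. ennreal (exp (t z)) \<partial>pair_law PX f\<^sub>0)"
    by (intro Z.product_nn_integral_prod) auto
  finally show ?thesis
    using nn_integral_pair_law_tilt[OF assms, of s] by (simp add: t_def)
qed

section \<open>Posterior bound from prior mass\<close>

text \<open>Both Jensen's inequality (\<open>A\<close> against the denominator) and the decoupling of numerator and
  denominator are instances of \<open>2 \<le> t + 1/t\<close>, with \<open>l\<close> the free parameter of the second one.\<close>

lemma (in prob_space) fractional_ratio_bound: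
  assumes [measurable]: "u \<in> borel_measurable M" "A \<in> sets M" "E \<in> sets M"
    and u: "\<And>\<theta>. 0 < u \<theta>" "\<And>\<theta>. u \<theta> \<le> (1::real)"
    and a: "0 < prob A" and c: "0 < c" and l: "0 < l"
  shows "ennreal ((LINT \<theta>:E|M. u \<theta>) / (LINT \<theta>|M. u \<theta>))
    \<le> ennreal (l / 2) * (\<integral>\<^sup>+\<theta>\<in>E. ennreal (c * u \<theta>) \<partial>M)
      + ennreal (1 / (2 * l * (prob A)\<^sup>2)) * (\<integral>\<^sup>+\<theta>\<in>A. ennreal (1 / (c * u \<theta>)) \<partial>M)"
    (is "ennreal (?N / ?D) \<le> _ * ?I + _ * ?U")
proof (cases "?D = 0 \<or> ?U = \<infinity>")
  \<comment> \<open>For \<open>?D = 0\<close> the quotient has the default value 0; for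
    \<open>?U = \<infinity>\<close> the right side is infinite.\<close>
  case True
  then show ?thesis using a l by (auto simp: ennreal_mult_top)
next
  case False
  have u_int [simp]: "integrable M u"
    by (rule integrable_const_bound[where B = 1]) (use u in \<open>auto simp: less_imp_le\<close>)
  have uE_int: "integrable M (\<lambda>\<theta>. indicator E \<theta> *\<^sub>R u \<theta>)"
    by (rule integrable_mult_indicator) auto
  have D: "0 < ?D"
    using False u by (intro order.not_eq_order_implies_strict integral_nonneg_AE) (auto simp: less_imp_le)
  have "0 \<le> ?N"
    unfolding set_lebesgue_integral_def using u by (intro integral_nonneg_AE) (auto simp: less_imp_le)
  moreover have "?N \<le> ?D"
    unfolding set_lebesgue_integral_def
    by (intro integral_mono[OF uE_int u_int]) (use u in \<open>auto simp: less_imp_le indicator_def\<close>)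
  ultimately have N: "0 \<le> ?N" "?N \<le> ?D" .
  obtain U where U: "?U = ennreal U" "0 \<le> U" using False by (cases ?U) auto
  have cu: "(\<integral>\<^sup>+\<theta>. ennreal (k * u \<theta>) \<partial>M) = ennreal (k * ?D)" if "0 \<le> k" for k
    using u that by (subst nn_integral_eq_integral) (auto simp: less_imp_le)
  have "?I = (\<integral>\<^sup>+\<theta>. ennreal (c * (indicator E \<theta> *\<^sub>R u \<theta>)) \<partial>M)"
    by (intro nn_integral_cong) (auto simp: indicator_def)
  also have "\<dots> = ennreal (\<integral>\<theta>. c * (indicator E \<theta> *\<^sub>R u \<theta>) \<partial>M)"
    using u c by (intro nn_integral_eq_integral integrable_mult_right uE_int AE_I2) (simp add: less_imp_le)
  finally have I: "?I = ennreal (c * ?N)"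
    by (simp only: integral_mult_right_zero set_lebesgue_integral_def)
  define a where "a = prob A"
  have a0: "0 < a" using assms(6) by (simp add: a_def)
  have aU: "a\<^sup>2 \<le> U * (c * ?D)"
  proof -
    \<comment> \<open>This choice makes the first term of the bound on \<open>a\<close> equal to
      \<open>a / 2\<close>, which the left side absorbs; what remains is
      \<open>a\<^sup>2 \<le> U * (c * ?D)\<close>.\<close>
    define t where "t = a / (c * ?D)"
    have t: "0 < t" using a0 c D by (simp add: t_def)
    have "1 \<le> t * c / 2 * u \<theta> + 1 / (2 * t) * (1 / (c * u \<theta>))" for \<theta>
    proof -
      define x where "x = t * (c * u \<theta>)"
      have x: "0 < x" using t c u by (simp add: x_def)
      have "0 \<le> (x - 1)\<^sup>2 / (2 * x)" using x by simp
      also have "\<dots> = x / 2 + 1 / (2 * x) - 1"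
        using x by (simp add: field_simps power2_eq_square)
      finally show ?thesis by (simp add: x_def mult.assoc)
    qed
    then have "(\<integral>\<^sup>+\<theta>. indicator A \<theta> \<partial>M)
      \<le> (\<integral>\<^sup>+\<theta>. ennreal (t * c / 2 * u \<theta>) + ennreal (1 / (2 * t)) * (ennreal (1 / (c * u \<theta>)) * indicator A \<theta>) \<partial>M)"
      using t c u
      by (intro nn_integral_mono)
        (auto simp: indicator_def less_imp_le simp flip: ennreal_mult ennreal_plus intro!: ennreal_leI[where x=1, simplified])
    also have "\<dots> = ennreal (t * c / 2 * ?D) + ennreal (1 / (2 * t)) * ?U"
      using t c cu[of "t * c / 2"] by (subst nn_integral_add) (auto simp: nn_integral_cmult)
    also have "\<dots> = ennreal (t * c / 2 * ?D + 1 / (2 * t) * U)"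
      using t c D U by (simp flip: ennreal_mult ennreal_plus)
    finally have "ennreal a \<le> ennreal (t * c / 2 * ?D + 1 / (2 * t) * U)"
      by (simp add: emeasure_eq_measure a_def)
    then have "a \<le> t * c / 2 * ?D + 1 / (2 * t) * U"
      using t c D U by (subst (asm) ennreal_le_iff) auto
    also have "\<dots> = a / 2 + U * (c * ?D) / (2 * a)"
      using a0 c D by (simp add: t_def)
    finally show ?thesis using a0 by (simp add: field_simps power2_eq_square)
  qed
  define y x where "y = ?N / ?D" and "x = l * c * ?D"
  have x: "0 < x" using l c D by (simp add: x_def)
  have y: "0 \<le> y" "y \<le> 1" using N D by (auto simp: y_def)
  \<comment> \<open>Here \<open>y \<le> 1\<close> enters: it gives
    \<open>y \<le> y * x / 2 + 1 / (2 * x)\<close>. In \<open>y * x\<close> the denominator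
    \<open>?D\<close> cancels, and in \<open>1 / x\<close> it is controlled by \<open>aU\<close>, so
    the two terms can be averaged over the data separately.\<close>
  have "0 \<le> (y * (x - 1)\<^sup>2 + (1 - y)) / (2 * x)" using x y by simp
  also have "\<dots> = y * x / 2 + 1 / (2 * x) - y"
    using x by (simp add: field_simps power2_eq_square)
  also have "1 / (2 * x) \<le> 1 / (2 * l * a\<^sup>2) * U"
    using aU a0 l c D x by (simp add: x_def field_simps)
  also have "y * x / 2 = l / 2 * (c * ?N)"
    using D by (simp add: x_def y_def)
  finally have "y \<le> l / 2 * (c * ?N) + 1 / (2 * l * a\<^sup>2) * U" by simp
  then show ?thesis
    using l c N U a0 unfolding I U(1) y_def[symmetric] a_def[symmetric]
    by (simp flip: ennreal_mult ennreal_plus)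
qed

section \<open>Measurability of the likelihood and transfer of the posterior to parameters\<close>

lemma log_lik_measurable:
  assumes [measurable]: "(\<lambda>(\<theta>, x). G \<theta> x) \<in> borel_measurable (P \<Otimes>\<^sub>M X)"
  shows "(\<lambda>(\<theta>, XY). log_lik n XY (G \<theta>))
     \<in> borel_measurable (P \<Otimes>\<^sub>M (\<Pi>\<^sub>M i\<in>{1..n}. X \<Otimes>\<^sub>M borel))"
proof -
  have [measurable]: "(\<lambda>z. G (fst z) (fst (snd z i)))
      \<in> borel_measurable (P \<Otimes>\<^sub>M (\<Pi>\<^sub>M i\<in>{1..n}. X \<Otimes>\<^sub>M borel))" if "i \<in> {1..n}" for i
  proof -
    have "(\<lambda>z. (fst z, fst (snd z i))) \<in> measurable (P \<Otimes>\<^sub>M (\<Pi>\<^sub>M i\<in>{1..n}. X \<Otimes>\<^sub>M borel)) (P \<Otimes>\<^sub>M X)"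
      using that by measurable
    from measurable_compose[OF this assms] show ?thesis by (simp add: case_prod_beta)
  qed
  show ?thesis unfolding log_lik_def case_prod_beta
    by (intro borel_measurable_times borel_measurable_sum borel_measurable_power borel_measurable_diff
        borel_measurable_const) (measurable)
qed

lemma log_lik_nonpos: "log_lik n XY f \<le> 0"
  by (simp add: log_lik_def sum_nonneg)

text \<open>Only evaluations at points of \<open>{0..1}\<close> generate the sigma-algebra of
  \<open>C01\<close>, hence the condition on the design points.\<close>

lemma log_lik_measurable_C01:
  assumes "\<And>i. i \<in> {1..n} \<Longrightarrow> fst (XY i) \<in> {0..1}"
  shows "log_lik n XY \<in> borel_measurable C01"
proof -
  have [measurable]: "(\<lambda>f. f (fst (XY i))) \<in> borel_measurable C01" if "i \<in> {1..n}" for i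
    unfolding C01_def using assms[OF that]
    by (intro measurable_restrict_space1 measurable_component_singleton)
  show ?thesis unfolding log_lik_def
    by (intro borel_measurable_times borel_measurable_sum borel_measurable_power borel_measurable_diff
        borel_measurable_const) measurable
qed

text \<open>Change of variables: the posterior is computed in the parameter space, where the map
  from parameter and design point to the function value can be jointly measurable, as Fubini
  requires.\<close>

lemma rho_posterior_distr:
  assumes G: "G \<in> measurable P C01" and B: "B \<in> sets C01"
    and XY: "\<And>i. i \<in> {1..n} \<Longrightarrow> fst (XY i) \<in> {0..1}"
  shows "rho_posterior \<rho> (distr P C01 G) n XY B =
     (LINT \<theta>:G -` B \<inter> space P|P. exp (\<rho> * log_lik n XY (G \<theta>)))
       / (LINT \<theta>|P. exp (\<rho> * log_lik n XY (G \<theta>)))"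
proof -
  note [measurable] = log_lik_measurable_C01[OF XY] G B
  have "(LINT f:B|distr P C01 G. exp (\<rho> * log_lik n XY f))
      = (LINT \<theta>|P. indicator B (G \<theta>) *\<^sub>R exp (\<rho> * log_lik n XY (G \<theta>)))"
    unfolding set_lebesgue_integral_def by (rule integral_distr) measurable
  also have "\<dots> = (LINT \<theta>:G -` B \<inter> space P|P. exp (\<rho> * log_lik n XY (G \<theta>)))"
    unfolding set_lebesgue_integral_def by (rule Bochner_Integration.integral_cong) (auto simp: indicator_def)
  moreover have "(LINT f|distr P C01 G. exp (\<rho> * log_lik n XY f))
      = (LINT \<theta>|P. exp (\<rho> * log_lik n XY (G \<theta>)))"
    by (rule integral_distr) measurable
  ultimately show ?thesis by (simp add: rho_posterior_def)
qed

text \<open>This spares a measurability proof for the clipped event: outside the \<open>\<sigma>\<close>-algebra the Bochner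
  integral in the numerator has the junk value 0.\<close>

lemma rho_posterior_not_measurable:
  assumes B: "B \<notin> sets C01" "B \<subseteq> space C01" and Q: "sets Q = sets C01"
    and XY: "\<And>i. i \<in> {1..n} \<Longrightarrow> fst (XY i) \<in> {0..1}"
  shows "rho_posterior \<rho> Q n XY B = 0"
proof -
  note [measurable] = log_lik_measurable_C01[OF XY]
  have "\<not> integrable Q (\<lambda>f. indicator B f *\<^sub>R exp (\<rho> * log_lik n XY f))" (is "\<not> integrable Q ?u")
  proof
    assume "integrable Q ?u"
    then have [measurable]: "?u \<in> borel_measurable C01"
      using borel_measurable_integrable measurable_cong_sets[OF Q refl] by blast
    have "{f \<in> space C01. ?u f \<noteq> 0} \<in> sets C01" by measurable
    also have "{f \<in> space C01. ?u f \<noteq> 0} = B" using B(2) by (auto simp: indicator_def)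
    finally show False using B(1) by simp
  qed
  then show ?thesis
    by (simp add: rho_posterior_def set_lebesgue_integral_def not_integrable_integral_eq)
qed

section \<open>Clipping and the expected likelihood ratio\<close>

lemma clip_measurable:
  assumes "design_distribution PX" and [measurable]: "f \<in> borel_measurable PX"
  shows "clip F f \<in> borel_measurable PX"
proof -
  have "(\<lambda>x. max (- F) (min (f x) F)) \<in> borel_measurable PX" by measurable
  then show ?thesis
    by (rule measurable_cong[THEN iffD1, rotated]) (simp add: clip_def design_space[OF assms(1)])
qed

text \<open>With \<open>t = \<rho> * (1 - \<rho>) / 2\<close> this is
  \<open>t / (1 + 4 * t * F\<^sup>2)\<close>, the slope of an affine upper bound of
  \<open>exp (- t * d)\<close> for squared distances \<open>d\<close> between 0 and
  \<open>4 * F\<^sup>2\<close>.\<close>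

definition clip_rate :: "real \<Rightarrow> real \<Rightarrow> real" where
  "clip_rate \<rho> F = (\<rho> * (1 - \<rho>) / 2) / (1 + 2 * \<rho> * (1 - \<rho>) * F\<^sup>2)"

lemma clip_rate_pos: "0 < \<rho> \<Longrightarrow> \<rho> < 1 \<Longrightarrow> 0 < clip_rate \<rho> F"
  unfolding clip_rate_def by (intro divide_pos_pos mult_pos_pos add_pos_nonneg) auto

text \<open>The clipped regression function is closer to \<open>f\<^sub>0\<close> and at bounded distance, where
  \<open>exp (- x) \<le> 1 / (1 + x)\<close> is below an affine function.\<close>

lemma affinity_le_clipped:
  assumes PX: "design_distribution PX"
    and [measurable]: "f\<^sub>0 \<in> borel_measurable PX" "f \<in> borel_measurable PX"
    and F: "0 < F" "\<And>x. x \<in> {0..1} \<Longrightarrow> \<bar>f\<^sub>0 x\<bar> \<le> F" and \<rho>: "0 < \<rho>" "\<rho> < 1"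
  shows "(\<integral>\<^sup>+x. ennreal (exp ((\<rho>\<^sup>2 - \<rho>) / 2 * (f x - f\<^sub>0 x)\<^sup>2)) \<partial>PX)
    \<le> ennreal (exp (- clip_rate \<rho> F * (L2_dist PX (clip F f) f\<^sub>0)\<^sup>2))"
proof -
  interpret X: prob_space PX using PX by (rule design_prob_space)
  note [measurable] = clip_measurable[OF PX]
  define t where "t = \<rho> * (1 - \<rho>) / 2"
  have t: "0 < t" using \<rho> by (simp add: t_def)
  have rate: "clip_rate \<rho> F = t / (1 + 4 * t * F\<^sup>2)" by (simp add: clip_rate_def t_def)
  have den: "0 < 1 + 4 * t * F\<^sup>2" using t by (simp add: add_pos_nonneg)
  define d where "d x = (clip F f x - f\<^sub>0 x)\<^sup>2" for x
  have [measurable]: "d \<in> borel_measurable PX" unfolding d_def by measurable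
  have d: "d x \<le> (f x - f\<^sub>0 x)\<^sup>2" "d x \<le> 4 * F\<^sup>2" "0 \<le> d x" if "x \<in> {0..1}" for x
  proof -
    have "\<bar>clip F f x - f\<^sub>0 x\<bar> \<le> \<bar>f x - f\<^sub>0 x\<bar>" "\<bar>clip F f x - f\<^sub>0 x\<bar> \<le> \<bar>2 * F\<bar>"
      using F(2)[OF that] F(1) that by (auto simp: clip_def)
    then show "d x \<le> (f x - f\<^sub>0 x)\<^sup>2" "d x \<le> 4 * F\<^sup>2" "0 \<le> d x"
      unfolding d_def abs_le_square_iff by auto
  qed
  have "exp ((\<rho>\<^sup>2 - \<rho>) / 2 * (f x - f\<^sub>0 x)\<^sup>2) \<le> 1 - clip_rate \<rho> F * d x" if x: "x \<in> {0..1}" for x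
  proof -
    have "exp ((\<rho>\<^sup>2 - \<rho>) / 2 * (f x - f\<^sub>0 x)\<^sup>2) = exp (- (t * (f x - f\<^sub>0 x)\<^sup>2))"
      by (simp add: t_def algebra_simps power2_eq_square diff_divide_distrib)
    also have "\<dots> \<le> exp (- (t * d x))" using d[OF x] t by simp
    also have "\<dots> \<le> 1 / (1 + t * d x)"
      using exp_ge_add_one_self[of "t * d x"] t d[OF x]
      by (simp add: exp_minus inverse_eq_divide frac_le add_pos_nonneg)
    also have "\<dots> = 1 - t * d x / (1 + t * d x)"
    proof -
      have "0 < 1 + t * d x" using t d[OF x] by (simp add: add_pos_nonneg)
      then show ?thesis by (simp add: field_simps)
    qed
    also have "\<dots> \<le> 1 - t * d x / (1 + 4 * t * F\<^sup>2)"
      using t d[OF x] by (intro diff_left_mono divide_left_mono) (auto intro!: mult_pos_pos add_pos_nonneg)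
    finally show ?thesis by (simp add: rate)
  qed
  then have "(\<integral>\<^sup>+x. ennreal (exp ((\<rho>\<^sup>2 - \<rho>) / 2 * (f x - f\<^sub>0 x)\<^sup>2)) \<partial>PX)
      \<le> (\<integral>\<^sup>+x. ennreal (1 - clip_rate \<rho> F * d x) \<partial>PX)"
    by (intro nn_integral_mono ennreal_leI) (simp add: design_space[OF PX])
  also have "\<dots> = ennreal (\<integral>x. 1 - clip_rate \<rho> F * d x \<partial>PX)"
  proof (rule nn_integral_eq_integral)
    have d_int: "integrable PX d"
      using d by (intro X.integrable_const_bound[where B = "4 * F\<^sup>2"]) (auto simp: design_space[OF PX])
    then show "integrable PX (\<lambda>x. 1 - clip_rate \<rho> F * d x)" by simp
    show "AE x in PX. 0 \<le> 1 - clip_rate \<rho> F * d x"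
    proof (rule AE_I2)
      fix x assume "x \<in> space PX"
      then have "t * d x \<le> t * (4 * F\<^sup>2)" using d[of x] t by (simp add: design_space[OF PX])
      then show "0 \<le> 1 - clip_rate \<rho> F * d x" using den by (simp add: rate field_simps)
    qed
  qed
  \<comment> \<open>The affine bound integrates to one in the squared loss, and
    \<open>1 - y \<le> exp (- y)\<close> restores the exponential form that is multiplicative in the
    sample size.\<close>
  also have "\<dots> \<le> ennreal (exp (- clip_rate \<rho> F * (L2_dist PX (clip F f) f\<^sub>0)\<^sup>2))"
  proof (rule ennreal_leI)
    have d_int: "integrable PX d"
      using d by (intro X.integrable_const_bound[where B = "4 * F\<^sup>2"]) (auto simp: design_space[OF PX])
    have "(L2_dist PX (clip F f) f\<^sub>0)\<^sup>2 = (\<integral>x. d x \<partial>PX)"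
      by (simp add: L2_dist_def d_def)
    then show "(\<integral>x. 1 - clip_rate \<rho> F * d x \<partial>PX) \<le> exp (- clip_rate \<rho> F * (L2_dist PX (clip F f) f\<^sub>0)\<^sup>2)"
      using exp_ge_add_one_self[of "- clip_rate \<rho> F * (\<integral>x. d x \<partial>PX)"] d_int
      by (simp add: X.prob_space)
  qed
  finally show ?thesis .
qed

text \<open>Tonelli for a non-negative integrand, followed by the product formula for a fixed
  parameter. It is applied with \<open>s = \<rho>\<close> on the bad event and with
  \<open>s = - \<rho>\<close> on the neighbourhood \<open>A\<close>.\<close>

lemma expected_tilt_swap:
  fixes s :: real and n :: nat
  assumes PX: "design_distribution PX" and P: "prob_space P"
    and f0 [measurable]: "f\<^sub>0 \<in> borel_measurable PX"
    and G [measurable]: "(\<lambda>(\<theta>, x). G \<theta> x) \<in> borel_measurable (P \<Otimes>\<^sub>M PX)"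
    and E [measurable]: "E \<in> sets P"
  defines "W \<equiv> \<lambda>\<theta> XY. ennreal (exp (s * (log_lik n XY (G \<theta>) - log_lik n XY f\<^sub>0)))"
  shows "(\<lambda>XY. \<integral>\<^sup>+\<theta>\<in>E. W \<theta> XY \<partial>P) \<in> borel_measurable (sample_law PX f\<^sub>0 n)" (is ?m)
    and "(\<integral>\<^sup>+XY. (\<integral>\<^sup>+\<theta>\<in>E. W \<theta> XY \<partial>P) \<partial>sample_law PX f\<^sub>0 n)
      = (\<integral>\<^sup>+\<theta>\<in>E. (\<integral>\<^sup>+x. ennreal (exp ((s\<^sup>2 - s) / 2 * (G \<theta> x - f\<^sub>0 x)\<^sup>2)) \<partial>PX) ^ n \<partial>P)" (is ?e)
proof -
  interpret P: prob_space P by (rule P)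
  interpret S: prob_space "sample_law PX f\<^sub>0 n"
    unfolding sample_law_def by (intro prob_space_PiM prob_space_pair_law PX f0)
  interpret PS: pair_sigma_finite P "sample_law PX f\<^sub>0 n" ..
  define l l\<^sub>0 where "l z = log_lik n (snd z) (G (fst z))" and "l\<^sub>0 z = log_lik n (snd z) f\<^sub>0"
    for z :: "'a \<times> (nat \<Rightarrow> real \<times> real)"
  have sets: "sets (P \<Otimes>\<^sub>M sample_law PX f\<^sub>0 n) = sets (P \<Otimes>\<^sub>M (\<Pi>\<^sub>M i\<in>{1..n}. PX \<Otimes>\<^sub>M borel))"
    by (intro sets_pair_measure_cong sets_sample_law refl)
  have [measurable]: "l \<in> borel_measurable (P \<Otimes>\<^sub>M sample_law PX f\<^sub>0 n)"
    using log_lik_measurable[OF G, of n]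
    unfolding measurable_cong_sets[OF sets refl] l_def by (simp add: case_prod_beta')
  have "(\<lambda>(\<theta>, x). f\<^sub>0 x) \<in> borel_measurable (P \<Otimes>\<^sub>M PX)" by measurable
  then have [measurable]: "l\<^sub>0 \<in> borel_measurable (P \<Otimes>\<^sub>M sample_law PX f\<^sub>0 n)"
    using log_lik_measurable[where G = "\<lambda>_. f\<^sub>0" and n = n and P = P and X = PX]
    unfolding measurable_cong_sets[OF sets refl] l\<^sub>0_def by (simp add: case_prod_beta')
  have "(\<lambda>z. ennreal (exp (s * (l z - l\<^sub>0 z))) * indicator E (fst z))
      \<in> borel_measurable (P \<Otimes>\<^sub>M sample_law PX f\<^sub>0 n)"
    by measurable
  then have W: "(\<lambda>(\<theta>, XY). W \<theta> XY * indicator E \<theta>) \<in> borel_measurable (P \<Otimes>\<^sub>M sample_law PX f\<^sub>0 n)"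
    by (simp add: W_def l_def l\<^sub>0_def case_prod_beta')
  show ?m
    using measurable_pair_swap[OF W] by (intro P.borel_measurable_nn_integral) (simp add: case_prod_beta')
  have "(\<integral>\<^sup>+XY. (\<integral>\<^sup>+\<theta>\<in>E. W \<theta> XY \<partial>P) \<partial>sample_law PX f\<^sub>0 n)
      = (\<integral>\<^sup>+\<theta>. \<integral>\<^sup>+XY. W \<theta> XY * indicator E \<theta> \<partial>sample_law PX f\<^sub>0 n \<partial>P)"
    by (rule PS.Fubini') (rule W)
  also have "\<dots> = (\<integral>\<^sup>+\<theta>\<in>E. (\<integral>\<^sup>+x. ennreal (exp ((s\<^sup>2 - s) / 2 * (G \<theta> x - f\<^sub>0 x)\<^sup>2)) \<partial>PX) ^ n \<partial>P)"
  proof (rule nn_integral_cong)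
    fix \<theta> assume \<theta>: "\<theta> \<in> space P"
    have "G \<theta> \<in> borel_measurable PX" using measurable_Pair2[OF G \<theta>] by simp
    from nn_integral_sample_law_tilt[OF PX f0 this, of n s]
    show "(\<integral>\<^sup>+XY. W \<theta> XY * indicator E \<theta> \<partial>sample_law PX f\<^sub>0 n)
       = (\<integral>\<^sup>+x. ennreal (exp ((s\<^sup>2 - s) / 2 * (G \<theta> x - f\<^sub>0 x)\<^sup>2)) \<partial>PX) ^ n * indicator E \<theta>"
      by (auto simp: W_def indicator_def)
  qed
  finally show ?e .
qed

text \<open>Averaging \<open>fractional_ratio_bound\<close> over the data gives one term decaying
  through \<open>clip_rate\<close> and one growing with \<open>V\<close> and
  \<open>\<delta>\<close>. Their product does not depend on the free parameter \<open>l\<close>, and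
  the bound is its square root, which accounts for the division by 2 in the exponent.\<close>

theorem clipped_posterior_bound:
  assumes PX: "design_distribution PX" and P: "prob_space P"
    and f0 [measurable]: "f\<^sub>0 \<in> borel_measurable PX"
    and F: "0 < F" "\<And>x. x \<in> {0..1} \<Longrightarrow> \<bar>f\<^sub>0 x\<bar> \<le> F" and \<rho>: "0 < \<rho>" "\<rho> < 1"
    and G [measurable]: "(\<lambda>(\<theta>, x). G \<theta> x) \<in> borel_measurable (P \<Otimes>\<^sub>M PX)"
    and GC: "G \<in> measurable P C01"
    and A: "A \<in> sets P" "exp (- V) \<le> measure P A"
    and near: "\<And>\<theta> x. \<theta> \<in> A \<Longrightarrow> x \<in> {0..1} \<Longrightarrow> \<bar>G \<theta> x - f\<^sub>0 x\<bar> \<le> \<delta>"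
    and r: "0 \<le> r"
  shows "(\<integral>XY. clipped_rho_posterior \<rho> F (distr P C01 G) n XY {f \<in> space C01. L2_dist PX f f\<^sub>0 \<ge> r}
            \<partial>sample_law PX f\<^sub>0 n)
    \<le> exp ((V + real n * (\<rho> * (1 + \<rho>) / 2 * \<delta>\<^sup>2) - real n * (clip_rate \<rho> F * r\<^sup>2)) / 2)"
proof -
  interpret P: prob_space P by (rule P)
  let ?S = "sample_law PX f\<^sub>0 n" and ?Q = "distr P C01 G"
  define B where "B = clip F -` {f \<in> space C01. L2_dist PX f f\<^sub>0 \<ge> r} \<inter> space ?Q"
  have X: "fst (XY i) \<in> {0..1}" if "XY \<in> space ?S" "i \<in> {1..n}" for XY i
  proof -
    have "XY \<in> space (\<Pi>\<^sub>M i\<in>{1..n}. PX \<Otimes>\<^sub>M borel)"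
      using that sets_eq_imp_space_eq[OF sets_sample_law] by blast
    then have "XY i \<in> space (PX \<Otimes>\<^sub>M borel)"
      using that(2) unfolding space_PiM by (rule PiE_mem)
    then show ?thesis by (auto simp: space_pair_measure design_space[OF PX])
  qed
  have Gm: "G \<theta> \<in> borel_measurable PX" if "\<theta> \<in> space P" for \<theta>
    using measurable_Pair2[OF G that] by simp
  show ?thesis
  proof (cases "B \<in> sets C01")
    case False
    have "clipped_rho_posterior \<rho> F ?Q n XY {f \<in> space C01. L2_dist PX f f\<^sub>0 \<ge> r} = 0" if "XY \<in> space ?S" for XY
      unfolding clipped_rho_posterior_def B_def[symmetric]
      by (rule rho_posterior_not_measurable[OF False]) (use X[OF that] in \<open>auto simp: B_def\<close>)
    then have "(\<integral>XY. clipped_rho_posterior \<rho> F ?Q n XY {f \<in> space C01. L2_dist PX f f\<^sub>0 \<ge> r} \<partial>?S) = (\<integral>XY. 0 \<partial>?S)"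
      by (intro Bochner_Integration.integral_cong) auto
    then show ?thesis by simp
  next
    case True
    define E where "E = G -` B \<inter> space P"
    have E: "E \<in> sets P" unfolding E_def using GC True by (rule measurable_sets)
    have Er: "r \<le> L2_dist PX (clip F (G \<theta>)) f\<^sub>0" "\<theta> \<in> space P" if "\<theta> \<in> E" for \<theta>
      using that by (auto simp: E_def B_def)
    define a where "a = P.prob A"
    have a: "0 < a" "exp (- V) \<le> a" using A(2) less_le_trans[OF exp_gt_zero] by (auto simp: a_def)
    define v\<^sub>1 v\<^sub>2 where "v\<^sub>1 = real n * (clip_rate \<rho> F * r\<^sup>2)" and "v\<^sub>2 = real n * (\<rho> * (1 + \<rho>) / 2 * \<delta>\<^sup>2)"
    \<comment> \<open>The value at which \<open>l * exp (- v\<^sub>1)\<close> and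
      \<open>exp (V + v\<^sub>2) / l\<close> coincide.\<close>
    define l where "l = exp ((V + v\<^sub>2 + v\<^sub>1) / 2)"
    have l: "0 < l" by (simp add: l_def)
    define I where "I s E XY = (\<integral>\<^sup>+\<theta>\<in>E. ennreal (exp (s * (log_lik n XY (G \<theta>) - log_lik n XY f\<^sub>0))) \<partial>P)" for s E XY
    have post: "ennreal (clipped_rho_posterior \<rho> F ?Q n XY {f \<in> space C01. L2_dist PX f f\<^sub>0 \<ge> r})
        \<le> ennreal (l / 2) * I \<rho> E XY + ennreal (1 / (2 * l * a\<^sup>2)) * I (- \<rho>) A XY" if XY: "XY \<in> space ?S" for XY
    proof -
      have "clipped_rho_posterior \<rho> F ?Q n XY {f \<in> space C01. L2_dist PX f f\<^sub>0 \<ge> r}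
        = (LINT \<theta>:E|P. exp (\<rho> * log_lik n XY (G \<theta>))) / (LINT \<theta>|P. exp (\<rho> * log_lik n XY (G \<theta>)))"
        unfolding clipped_rho_posterior_def B_def[symmetric] E_def
        by (rule rho_posterior_distr[OF GC True]) (use X[OF XY] in auto)
      moreover have [measurable]: "(\<lambda>\<theta>. log_lik n XY (G \<theta>)) \<in> borel_measurable P"
        by (rule measurable_compose[OF GC log_lik_measurable_C01]) (use X[OF XY] in auto)
      \<comment> \<open>The likelihood at \<open>f\<^sub>0\<close> enters as the constant
        \<open>c\<close> of \<open>fractional_ratio_bound\<close> and leaves the ratio unchanged;
        the unnormalised likelihood plays the role of \<open>u\<close>, being at most 1.\<close>
      have "ennreal ((LINT \<theta>:E|P. exp (\<rho> * log_lik n XY (G \<theta>))) / (LINT \<theta>|P. exp (\<rho> * log_lik n XY (G \<theta>))))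
        \<le> ennreal (l / 2) * (\<integral>\<^sup>+\<theta>\<in>E. ennreal (exp (- \<rho> * log_lik n XY f\<^sub>0) * exp (\<rho> * log_lik n XY (G \<theta>))) \<partial>P)
      + ennreal (1 / (2 * l * (P.prob A)\<^sup>2)) *
          (\<integral>\<^sup>+\<theta>\<in>A. ennreal (1 / (exp (- \<rho> * log_lik n XY f\<^sub>0) * exp (\<rho> * log_lik n XY (G \<theta>)))) \<partial>P)"
        using a l \<rho> A(1) E
        by (intro P.fractional_ratio_bound) (auto simp: a_def mult_nonneg_nonpos log_lik_nonpos)
      moreover have "1 / (exp (- \<rho> * log_lik n XY f\<^sub>0) * exp (\<rho> * log_lik n XY (G \<theta>)))
          = exp (- \<rho> * (log_lik n XY (G \<theta>) - log_lik n XY f\<^sub>0))" for \<theta>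
        by (simp add: exp_minus[symmetric] inverse_eq_divide[symmetric] algebra_simps flip: exp_add)
      moreover have "exp (- \<rho> * log_lik n XY f\<^sub>0) * exp (\<rho> * log_lik n XY (G \<theta>))
          = exp (\<rho> * (log_lik n XY (G \<theta>) - log_lik n XY f\<^sub>0))" for \<theta>
        by (simp add: algebra_simps flip: exp_add)
      ultimately show ?thesis by (simp only: I_def a_def)
    qed
    have "(\<integral>\<^sup>+XY. I \<rho> E XY \<partial>?S)
        = (\<integral>\<^sup>+\<theta>\<in>E. (\<integral>\<^sup>+x. ennreal (exp ((\<rho>\<^sup>2 - \<rho>) / 2 * (G \<theta> x - f\<^sub>0 x)\<^sup>2)) \<partial>PX) ^ n \<partial>P)"
      unfolding I_def by (rule expected_tilt_swap(2)[OF PX P f0 G E])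
    also have "\<dots> \<le> (\<integral>\<^sup>+\<theta>. ennreal (exp (- v\<^sub>1)) \<partial>P)"
    proof (rule nn_integral_mono)
      fix \<theta> assume "\<theta> \<in> space P"
      have "(\<integral>\<^sup>+x. ennreal (exp ((\<rho>\<^sup>2 - \<rho>) / 2 * (G \<theta> x - f\<^sub>0 x)\<^sup>2)) \<partial>PX) ^ n \<le> ennreal (exp (- v\<^sub>1))"
        if "\<theta> \<in> E"
      proof -
        have "(\<integral>\<^sup>+x. ennreal (exp ((\<rho>\<^sup>2 - \<rho>) / 2 * (G \<theta> x - f\<^sub>0 x)\<^sup>2)) \<partial>PX) ^ n
          \<le> ennreal (exp (- clip_rate \<rho> F * (L2_dist PX (clip F (G \<theta>)) f\<^sub>0)\<^sup>2)) ^ n"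
          using Er[OF that] by (intro power_mono affinity_le_clipped PX f0 Gm F \<rho>) auto
        also have "\<dots> \<le> ennreal (exp (- clip_rate \<rho> F * r\<^sup>2)) ^ n"
          using Er[OF that] clip_rate_pos[OF \<rho>, of F] r
          by (intro power_mono ennreal_leI) (auto intro!: mult_left_mono power_mono)
        also have "\<dots> = ennreal (exp (- v\<^sub>1))"
          by (simp add: ennreal_power v\<^sub>1_def flip: exp_of_nat_mult)
        finally show ?thesis .
      qed
      then show "(\<integral>\<^sup>+x. ennreal (exp ((\<rho>\<^sup>2 - \<rho>) / 2 * (G \<theta> x - f\<^sub>0 x)\<^sup>2)) \<partial>PX) ^ n * indicator E \<theta> \<le> ennreal (exp (- v\<^sub>1))"
        by (auto simp: indicator_def)
    qed
    finally have IE: "(\<integral>\<^sup>+XY. I \<rho> E XY \<partial>?S) \<le> ennreal (exp (- v\<^sub>1))"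
      by (simp add: P.emeasure_space_1)
    have "(\<integral>\<^sup>+XY. I (- \<rho>) A XY \<partial>?S)
        = (\<integral>\<^sup>+\<theta>\<in>A. (\<integral>\<^sup>+x. ennreal (exp (((- \<rho>)\<^sup>2 - - \<rho>) / 2 * (G \<theta> x - f\<^sub>0 x)\<^sup>2)) \<partial>PX) ^ n \<partial>P)"
      unfolding I_def by (rule expected_tilt_swap(2)[OF PX P f0 G A(1)])
    also have "\<dots> \<le> (\<integral>\<^sup>+\<theta>. ennreal (exp v\<^sub>2) * indicator A \<theta> \<partial>P)"
    proof (rule nn_integral_mono)
      interpret X: prob_space PX using PX by (rule design_prob_space)
      fix \<theta> assume "\<theta> \<in> space P"
      have "(\<integral>\<^sup>+x. ennreal (exp (((- \<rho>)\<^sup>2 - - \<rho>) / 2 * (G \<theta> x - f\<^sub>0 x)\<^sup>2)) \<partial>PX) ^ n \<le> ennreal (exp v\<^sub>2)"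
        if "\<theta> \<in> A"
      proof -
        have "((- \<rho>)\<^sup>2 - - \<rho>) / 2 * (G \<theta> x - f\<^sub>0 x)\<^sup>2 \<le> \<rho> * (1 + \<rho>) / 2 * \<delta>\<^sup>2" if "x \<in> space PX" for x
        proof -
          have "(G \<theta> x - f\<^sub>0 x)\<^sup>2 \<le> \<delta>\<^sup>2"
            using power_mono[OF near[OF \<open>\<theta> \<in> A\<close>, of x], of 2] that by (simp add: design_space[OF PX])
          then have "\<rho> * (1 + \<rho>) / 2 * (G \<theta> x - f\<^sub>0 x)\<^sup>2 \<le> \<rho> * (1 + \<rho>) / 2 * \<delta>\<^sup>2"
            using \<rho> by (intro mult_left_mono) auto
          then show ?thesis by (simp add: power2_eq_square algebra_simps)
        qed
        then have "(\<integral>\<^sup>+x. ennreal (exp (((- \<rho>)\<^sup>2 - - \<rho>) / 2 * (G \<theta> x - f\<^sub>0 x)\<^sup>2)) \<partial>PX)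
          \<le> (\<integral>\<^sup>+x. ennreal (exp (\<rho> * (1 + \<rho>) / 2 * \<delta>\<^sup>2)) \<partial>PX)"
          by (intro nn_integral_mono ennreal_leI) simp
        also have "\<dots> = ennreal (exp (\<rho> * (1 + \<rho>) / 2 * \<delta>\<^sup>2))"
          by (simp add: X.emeasure_space_1)
        finally show ?thesis
          using power_mono[of _ "ennreal (exp (\<rho> * (1 + \<rho>) / 2 * \<delta>\<^sup>2))" n]
          by (simp add: ennreal_power v\<^sub>2_def flip: exp_of_nat_mult)
      qed
      then show "(\<integral>\<^sup>+x. ennreal (exp (((- \<rho>)\<^sup>2 - - \<rho>) / 2 * (G \<theta> x - f\<^sub>0 x)\<^sup>2)) \<partial>PX) ^ n * indicator A \<theta>
          \<le> ennreal (exp v\<^sub>2) * indicator A \<theta>"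
        by (auto simp: indicator_def)
    qed
    \<comment> \<open>The integral over \<open>A\<close> contributes one factor \<open>a\<close>. It
      cancels one of the two in the denominator, so the prior mass costs \<open>exp V\<close> only
      once.\<close>
    also have "\<dots> = ennreal (exp v\<^sub>2 * a)"
      using A(1) by (simp add: nn_integral_cmult_indicator P.emeasure_eq_measure a_def ennreal_mult)
    finally have IA: "(\<integral>\<^sup>+XY. I (- \<rho>) A XY \<partial>?S) \<le> ennreal (exp v\<^sub>2 * a)" .
    have [measurable]: "I \<rho> E \<in> borel_measurable ?S" "I (- \<rho>) A \<in> borel_measurable ?S"
      unfolding I_def by (rule expected_tilt_swap(1)[OF PX P f0 G E], rule expected_tilt_swap(1)[OF PX P f0 G A(1)])
    have "(\<integral>\<^sup>+XY. ennreal (clipped_rho_posterior \<rho> F ?Q n XY {f \<in> space C01. L2_dist PX f f\<^sub>0 \<ge> r}) \<partial>?S)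
      \<le> (\<integral>\<^sup>+XY. ennreal (l / 2) * I \<rho> E XY + ennreal (1 / (2 * l * a\<^sup>2)) * I (- \<rho>) A XY \<partial>?S)"
      by (intro nn_integral_mono post)
    also have "\<dots> = ennreal (l / 2) * (\<integral>\<^sup>+XY. I \<rho> E XY \<partial>?S) + ennreal (1 / (2 * l * a\<^sup>2)) * (\<integral>\<^sup>+XY. I (- \<rho>) A XY \<partial>?S)"
      by (simp add: nn_integral_add nn_integral_cmult)
    also have "\<dots> \<le> ennreal (l / 2) * ennreal (exp (- v\<^sub>1)) + ennreal (1 / (2 * l * a\<^sup>2)) * ennreal (exp v\<^sub>2 * a)"
      by (intro add_mono mult_left_mono IE IA) auto
    also have "\<dots> = ennreal (l / 2 * exp (- v\<^sub>1) + exp v\<^sub>2 / (2 * l * a))"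
      using l a by (simp add: power2_eq_square flip: ennreal_mult ennreal_plus)
    also have "\<dots> \<le> ennreal (exp ((V + v\<^sub>2 - v\<^sub>1) / 2))"
    proof (rule ennreal_leI)
      define e where "e = exp ((V + v\<^sub>2 - v\<^sub>1) / 2)"
      have "l * exp (- v\<^sub>1) = e"
        by (simp add: l_def e_def field_simps flip: exp_add)
      then have *: "l / 2 * exp (- v\<^sub>1) = e / 2" by simp
      have "exp v\<^sub>2 / (l * a) \<le> exp v\<^sub>2 / (l * exp (- V))"
        using a l by (intro divide_left_mono mult_left_mono mult_pos_pos) auto
      also have "\<dots> = e"
        by (simp add: l_def e_def field_simps flip: exp_add exp_diff)
      finally have "exp v\<^sub>2 / (2 * l * a) \<le> e / 2" by simp
      then show "l / 2 * exp (- v\<^sub>1) + exp v\<^sub>2 / (2 * l * a) \<le> exp ((V + v\<^sub>2 - v\<^sub>1) / 2)"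
        unfolding e_def[symmetric] * by linarith
    qed
    \<comment> \<open>A bound on the non-negative integral bounds the Bochner integral as well;
      without integrability the latter has the default value 0.\<close>
    finally show ?thesis unfolding v\<^sub>1_def v\<^sub>2_def
      by (intro integral_real_bounded) auto
  qed
qed

section \<open>Interpolation of Hoelder functions by ReLU networks\<close>

lemma strict_floor_eq_0: "0 < \<beta> \<Longrightarrow> \<beta> \<le> 1 \<Longrightarrow> strict_floor \<beta> = 0"
  by (simp add: strict_floor_def ceiling_le_one)

lemma strict_floor_eq_1: "1 < \<beta> \<Longrightarrow> \<beta> \<le> 2 \<Longrightarrow> strict_floor \<beta> = 1"
proof -
  assume "1 < \<beta>" "\<beta> \<le> 2"
  then have "\<lceil>\<beta>\<rceil> = 2" by (intro ceiling_unique) auto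
  then show ?thesis by (simp add: strict_floor_def)
qed

text \<open>Both summands of the extended-real norm are non-negative, so each of them alone is at
  most \<open>L\<close>, and so is every member of either supremum.\<close>

lemma holder_ballE:
  assumes "f \<in> holder_ball \<beta> L"
  obtains D where "\<And>x. x \<in> {0..1} \<Longrightarrow> D 0 x = f x"
    and "\<And>i x. i < strict_floor \<beta> \<Longrightarrow> x \<in> {0..1} \<Longrightarrow>
      (D i has_real_derivative D (Suc i) x) (at x within {0..1})"
    and "\<And>i x. i \<le> strict_floor \<beta> \<Longrightarrow> x \<in> {0..1} \<Longrightarrow> \<bar>D i x\<bar> \<le> L"
    and "\<And>x y. x \<in> {0..1} \<Longrightarrow> y \<in> {0..1} \<Longrightarrow>
      \<bar>D (strict_floor \<beta>) x - D (strict_floor \<beta>) y\<bar> \<le> L * \<bar>x - y\<bar> powr (\<beta> - real (strict_floor \<beta>))"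
proof -
  define s where "s = strict_floor \<beta>"
  let ?T = "{(x, y). x \<in> {0..1::real} \<and> y \<in> {0..1::real} \<and> x \<noteq> y}"
  obtain D where D0: "\<forall>x\<in>{0..1}. D 0 x = f x"
    and D1: "\<forall>i<s. \<forall>x\<in>{0..1}. (D i has_real_derivative D (Suc i) x) (at x within {0..1})"
    and D2: "(MAX i\<in>{..s}. SUP x\<in>{0..1::real}. ereal \<bar>D i x\<bar>)
       + (SUP (x, y)\<in>?T. ereal (\<bar>D s x - D s y\<bar> / \<bar>x - y\<bar> powr (\<beta> - real s))) \<le> ereal L" (is "?A + ?B \<le> _")
    using assms unfolding holder_ball_def s_def by blast
  have A: "ereal \<bar>D i x\<bar> \<le> ?A" if "i \<le> s" "x \<in> {0..1}" for i x
  proof -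
    have "ereal \<bar>D i x\<bar> \<le> (SUP x\<in>{0..1}. ereal \<bar>D i x\<bar>)" using that by (intro SUP_upper)
    also have "\<dots> \<le> ?A" using that by (intro Max_ge) auto
    finally show ?thesis .
  qed
  have B: "ereal (\<bar>D s x - D s y\<bar> / \<bar>x - y\<bar> powr (\<beta> - real s)) \<le> ?B"
    if "x \<in> {0..1}" "y \<in> {0..1}" "x \<noteq> y" for x y
    using that by (intro SUP_upper2[where i = "(x, y)"]) auto
  have A0: "0 \<le> ?A" using A[of 0 0] by (rule order_trans[rotated]) auto
  have B0: "0 \<le> ?B" using B[of 0 1] by (rule order_trans[rotated]) auto
  have AL: "?A \<le> ereal L" by (rule order_trans[OF add_increasing2[OF B0 order_refl] D2])
  have BL: "?B \<le> ereal L" by (rule order_trans[OF add_increasing[OF A0 order_refl] D2])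
  show thesis
  proof (rule that[of D, folded s_def])
    show "\<bar>D i x\<bar> \<le> L" if "i \<le> s" "x \<in> {0..1}" for i x
      using order_trans[OF A[OF that] AL] by simp
    show "\<bar>D s x - D s y\<bar> \<le> L * \<bar>x - y\<bar> powr (\<beta> - real s)" if "x \<in> {0..1}" "y \<in> {0..1}" for x y
    proof (cases "x = y")
      case False
      then show ?thesis
        using order_trans[OF B[OF that False] BL] by (simp add: field_simps)
    qed simp
  qed (use D0 D1 in auto)
qed

lemma holder_ball_low:
  assumes "f \<in> holder_ball \<beta> L" "0 < \<beta>" "\<beta> \<le> 1" "x \<in> {0..1}" "y \<in> {0..1}"
  shows "\<bar>f x - f y\<bar> \<le> L * \<bar>x - y\<bar> powr \<beta>"
  using assms by (auto elim!: holder_ballE simp: strict_floor_eq_0)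

text \<open>The mean value theorem is stated along with the derivative because difference quotients
  are all that the interpolation bounds use. Its points are interior, while the derivative itself is
  one-sided at the end points of the interval.\<close>

lemma holder_ball_high:
  assumes "f \<in> holder_ball \<beta> L" "1 < \<beta>" "\<beta> \<le> 2"
  shows "\<exists>f'. (\<forall>x\<in>{0..1}. (f has_real_derivative f' x) (at x within {0..1}))
    \<and> (\<forall>x\<in>{0..1}. \<bar>f' x\<bar> \<le> L)
    \<and> (\<forall>x\<in>{0..1}. \<forall>y\<in>{0..1}. \<bar>f' x - f' y\<bar> \<le> L * \<bar>x - y\<bar> powr (\<beta> - 1))
    \<and> (\<forall>a b. 0 \<le> a \<longrightarrow> a < b \<longrightarrow> b \<le> 1 \<longrightarrow> (\<exists>\<xi>\<in>{a<..<b}. f b - f a = f' \<xi> * (b - a)))"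
  using assms(1)
proof (rule holder_ballE)
  fix D
  assume D: "\<And>x. x \<in> {0..1} \<Longrightarrow> D 0 x = f x"
    "\<And>i x. i < strict_floor \<beta> \<Longrightarrow> x \<in> {0..1} \<Longrightarrow> (D i has_real_derivative D (Suc i) x) (at x within {0..1})"
    "\<And>i x. i \<le> strict_floor \<beta> \<Longrightarrow> x \<in> {0..1} \<Longrightarrow> \<bar>D i x\<bar> \<le> L"
    "\<And>x y. x \<in> {0..1} \<Longrightarrow> y \<in> {0..1} \<Longrightarrow>
      \<bar>D (strict_floor \<beta>) x - D (strict_floor \<beta>) y\<bar> \<le> L * \<bar>x - y\<bar> powr (\<beta> - real (strict_floor \<beta>))"
  have s: "strict_floor \<beta> = 1" using assms by (intro strict_floor_eq_1)
  have der: "(f has_real_derivative D 1 x) (at x within {0..1})" if "x \<in> {0..1}" for x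
    by (rule has_field_derivative_transform_within[where f = "D 0" and d = 1])
      (use D(1) D(2)[of 0 x] that in \<open>auto simp: s\<close>)
  have mvt: "\<exists>\<xi>\<in>{a<..<b}. f b - f a = D 1 \<xi> * (b - a)" if ab: "0 \<le> a" "a < b" "b \<le> 1" for a b
  proof -
    have "(f has_derivative (\<lambda>h. D 1 x * h)) (at x within {a..b})" if "a \<le> x" "x \<le> b" for x
      using DERIV_subset[OF der, of x "{a..b}"] that ab by (auto simp: has_field_derivative_def)
    from mvt_simple[OF ab(2) this] show ?thesis .
  qed
  show ?thesis
    by (intro exI[of _ "D 1"]) (use der mvt D(3)[of 1] D(4) in \<open>auto simp: s\<close>)
qed

text \<open>This supplies the measurability of the true regression function with respect to the
  design distribution.\<close>

lemma holder_ball_continuous: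
  assumes "f \<in> holder_ball \<beta> L" "0 < \<beta>" "\<beta> \<le> 2"
  shows "continuous_on {0..1} f"
proof (cases "\<beta> \<le> 1")
  case True
  show ?thesis unfolding continuous_on_def
  proof
    fix x :: real assume x: "x \<in> {0..1}"
    have "((\<lambda>y. L * \<bar>y - x\<bar> powr \<beta>) \<longlongrightarrow> L * \<bar>x - x\<bar> powr \<beta>) (at x within {0..1})"
      using assms(2) by (intro tendsto_intros) auto
    then have "((\<lambda>y. L * \<bar>y - x\<bar> powr \<beta>) \<longlongrightarrow> 0) (at x within {0..1})" by simp
    moreover have "\<forall>\<^sub>F y in at x within {0..1}. norm (f y - f x) \<le> L * \<bar>y - x\<bar> powr \<beta>"
      unfolding eventually_at_filter real_norm_def
      by (intro always_eventually allI impI holder_ball_low[OF assms(1,2) True _ x])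
    ultimately have "((\<lambda>y. f y - f x) \<longlongrightarrow> 0) (at x within {0..1})"
      by (rule Lim_null_comparison[rotated])
    then show "(f \<longlongrightarrow> f x) (at x within {0..1})" by (rule LIM_zero_cancel)
  qed
next
  case False
  then have "1 < \<beta>" by simp
  from holder_ball_high[OF assms(1) this assms(3)] obtain f'
    where "\<forall>x\<in>{0..1}. (f has_real_derivative f' x) (at x within {0..1})" by blast
  then show ?thesis by (intro DERIV_continuous_on) blast
qed

section \<open>Interpolation error and finite differences on a single cell\<close>

lemma powr_mono_scale:
  fixes d h :: real
  assumes "0 \<le> d" "d \<le> h" "0 \<le> b" "0 \<le> L"
  shows "L * d powr b \<le> L * h powr b"
  using assms by (intro mult_left_mono powr_mono2)

context
  fixes f :: "real \<Rightarrow> real" and \<beta> L h :: real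
  assumes f: "f \<in> holder_ball \<beta> L" and \<beta>: "0 < \<beta>" "\<beta> \<le> 2" and L: "0 < L" and h: "0 < h"
begin

text \<open>For \<open>\<beta> \<le> 1\<close> the interpolant is a convex combination of two values
  of \<open>f\<close>, each close to \<open>f x\<close>. For \<open>\<beta> > 1\<close> the mean
  value theorem on \<open>[a, x]\<close> and on the whole cell writes the error as
  \<open>x - a\<close> times a difference of two derivatives, and the Hoelder bound on
  \<open>f'\<close> supplies the missing power \<open>\<beta> - 1\<close>.\<close>

lemma linear_interpolation_error:
  assumes a: "0 \<le> a" "a + h \<le> 1" and x: "a \<le> x" "x \<le> a + h"
  shows "\<bar>f a + (f (a + h) - f a) / h * (x - a) - f x\<bar> \<le> L * h powr \<beta>"
proof (cases "\<beta> \<le> 1")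
  case True
  define t where "t = (x - a) / h"
  have t: "0 \<le> t" "t \<le> 1" using x h by (auto simp: t_def)
  have "\<bar>f a - f x\<bar> \<le> L * h powr \<beta>" "\<bar>f (a + h) - f x\<bar> \<le> L * h powr \<beta>"
    using x a \<beta> L by (auto intro!: order_trans[OF holder_ball_low[OF f \<beta>(1) True]] powr_mono_scale)
  then have "(1 - t) * \<bar>f a - f x\<bar> + t * \<bar>f (a + h) - f x\<bar> \<le> L * h powr \<beta>"
    using t by (intro convex_bound_le) auto
  moreover have "\<bar>(1 - t) * (f a - f x) + t * (f (a + h) - f x)\<bar> \<le> (1 - t) * \<bar>f a - f x\<bar> + t * \<bar>f (a + h) - f x\<bar>"
    using t by (intro order_trans[OF abs_triangle_ineq]) (simp add: abs_mult)
  moreover have "f a + (f (a + h) - f a) / h * (x - a) - f x = (1 - t) * (f a - f x) + t * (f (a + h) - f x)"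
    using h by (simp add: t_def field_simps)
  ultimately show ?thesis by simp
next
  case False
  then have "1 < \<beta>" by simp
  from holder_ball_high[OF f this \<beta>(2)] obtain f' where "\<forall>x\<in>{0..1}. \<bar>f' x\<bar> \<le> L"
    "\<forall>x\<in>{0..1}. \<forall>y\<in>{0..1}. \<bar>f' x - f' y\<bar> \<le> L * \<bar>x - y\<bar> powr (\<beta> - 1)"
    "\<forall>a b. 0 \<le> a \<longrightarrow> a < b \<longrightarrow> b \<le> 1 \<longrightarrow> (\<exists>\<xi>\<in>{a<..<b}. f b - f a = f' \<xi> * (b - a))"
    by blast
  note f' = this[rule_format]
  show ?thesis
  proof (cases "x = a")
    case False
    obtain u where u: "u \<in> {a<..<x}" "f x - f a = f' u * (x - a)"
      using f'(3)[of a x] False x a by auto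
    obtain v where v: "v \<in> {a<..<a + h}" "f (a + h) - f a = f' v * (a + h - a)"
      using f'(3)[of a "a + h"] h a by auto
    have "f a + (f (a + h) - f a) / h * (x - a) - f x = (x - a) * (f' v - f' u)"
      using u(2) v(2) h by (simp add: algebra_simps)
    then have "\<bar>f a + (f (a + h) - f a) / h * (x - a) - f x\<bar> = (x - a) * \<bar>f' v - f' u\<bar>"
      using x by (simp add: abs_mult)
    also have "\<bar>f' v - f' u\<bar> \<le> L * h powr (\<beta> - 1)"
      using u(1) v(1) x a \<open>\<not> \<beta> \<le> 1\<close> L
      by (intro order_trans[OF f'(2)] powr_mono_scale) auto
    then have "(x - a) * \<bar>f' v - f' u\<bar> \<le> h * (L * h powr (\<beta> - 1))"
      using x L by (intro mult_mono) auto
    also have "\<dots> = L * h powr \<beta>" using h by (simp add: powr_mult_base[symmetric] powr_diff)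
    finally show ?thesis .
  qed (use L in simp)
qed

text \<open>The first-order parts cancel: for \<open>\<beta> > 1\<close> the second difference is
  \<open>h\<close> times the difference of two derivatives at distance at most \<open>2 * h\<close>,
  and \<open>2 powr (\<beta> - 1) \<le> 2\<close> because \<open>\<beta> \<le> 2\<close>.\<close>

lemma second_difference_bound:
  assumes a: "0 \<le> a - h" "a + h \<le> 1"
  shows "\<bar>f (a + h) - 2 * f a + f (a - h)\<bar> \<le> 2 * L * h powr \<beta>"
proof (cases "\<beta> \<le> 1")
  case True
  have "\<bar>f (a + h) - f a\<bar> \<le> L * h powr \<beta>" "\<bar>f (a - h) - f a\<bar> \<le> L * h powr \<beta>"
    using a \<beta> L h by (auto intro!: order_trans[OF holder_ball_low[OF f \<beta>(1) True]])
  then show ?thesis by linarith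
next
  case False
  then have "1 < \<beta>" by simp
  from holder_ball_high[OF f this \<beta>(2)] obtain f' where "\<forall>x\<in>{0..1}. \<bar>f' x\<bar> \<le> L"
    "\<forall>x\<in>{0..1}. \<forall>y\<in>{0..1}. \<bar>f' x - f' y\<bar> \<le> L * \<bar>x - y\<bar> powr (\<beta> - 1)"
    "\<forall>a b. 0 \<le> a \<longrightarrow> a < b \<longrightarrow> b \<le> 1 \<longrightarrow> (\<exists>\<xi>\<in>{a<..<b}. f b - f a = f' \<xi> * (b - a))"
    by blast
  note f' = this[rule_format]
  obtain u where u: "u \<in> {a - h<..<a}" "f a - f (a - h) = f' u * (a - (a - h))"
    using f'(3)[of "a - h" a] h a by auto
  obtain v where v: "v \<in> {a<..<a + h}" "f (a + h) - f a = f' v * (a + h - a)"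
    using f'(3)[of a "a + h"] h a by auto
  have "\<bar>f (a + h) - 2 * f a + f (a - h)\<bar> = h * \<bar>f' v - f' u\<bar>"
    using u(2) v(2) h by (simp add: abs_mult_pos' algebra_simps)
  also have "\<bar>f' v - f' u\<bar> \<le> L * (2 * h) powr (\<beta> - 1)"
    using u(1) v(1) a \<open>\<not> \<beta> \<le> 1\<close> L
    by (intro order_trans[OF f'(2)] powr_mono_scale) auto
  also have "\<dots> \<le> L * (2 * h powr (\<beta> - 1))"
  proof -
    have "(2 * h) powr (\<beta> - 1) = 2 powr (\<beta> - 1) * h powr (\<beta> - 1)" using h by (simp add: powr_mult)
    also have "2 powr (\<beta> - 1) \<le> (2::real) powr 1" using \<beta> by (intro powr_mono) auto
    finally show ?thesis using L by (simp add: mult_right_mono)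
  qed
  finally have "\<bar>f (a + h) - 2 * f a + f (a - h)\<bar> \<le> h * (L * (2 * h powr (\<beta> - 1)))"
    using h by simp
  also have "\<dots> = 2 * L * h powr \<beta>" using h by (simp add: powr_diff)
  finally show ?thesis .
qed

text \<open>Used for the initial slope only, which has no neighbouring slope to cancel against;
  smoothness beyond 1 brings no gain there.\<close>

lemma first_difference_bound:
  assumes a: "0 \<le> a" "a + h \<le> 1"
  shows "\<bar>f (a + h) - f a\<bar> \<le> L * h powr min \<beta> 1"
proof (cases "\<beta> \<le> 1")
  case True
  then show ?thesis
    using holder_ball_low[OF f \<beta>(1) True, of "a + h" a] a h by (simp add: min_def)
next
  case False
  then have "1 < \<beta>" by simp
  from holder_ball_high[OF f this \<beta>(2)] obtain f' where "\<forall>x\<in>{0..1}. \<bar>f' x\<bar> \<le> L"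
    "\<forall>x\<in>{0..1}. \<forall>y\<in>{0..1}. \<bar>f' x - f' y\<bar> \<le> L * \<bar>x - y\<bar> powr (\<beta> - 1)"
    "\<forall>a b. 0 \<le> a \<longrightarrow> a < b \<longrightarrow> b \<le> 1 \<longrightarrow> (\<exists>\<xi>\<in>{a<..<b}. f b - f a = f' \<xi> * (b - a))"
    by blast
  note f' = this[rule_format]
  obtain v where v: "v \<in> {a<..<a + h}" "f (a + h) - f a = f' v * (a + h - a)"
    using f'(3)[of a "a + h"] h a by auto
  then show ?thesis using f'(1)[of v] a h False by (simp add: abs_mult min_def mult.commute)
qed

end

text \<open>Coefficients of the piecewise linear interpolant on the grid \<open>j / K\<close> in the
  basis of hinge functions: the initial slope for \<open>j = 0\<close>, the change of slope at the
  knot for every other \<open>j\<close>.\<close>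

definition interp_weight :: "(real \<Rightarrow> real) \<Rightarrow> nat \<Rightarrow> nat \<Rightarrow> real" where
  "interp_weight f K j = real K * (if j = 0 then f (1 / real K) - f 0
     else f (real j / real K + 1 / real K) - 2 * f (real j / real K) + f (real j / real K - 1 / real K))"

text \<open>The partial sum is the chord over cell \<open>i\<close>, taken as an affine function on
  the whole line; adding the slope change at the right knot rotates it into the next chord. As
  \<open>x\<close> is unrestricted, the induction needs no case distinction.\<close>

lemma interpolant_on_cell:
  assumes K: "0 < K"
  shows "f 0 + (\<Sum>j\<le>i. interp_weight f K j * (x - real j / real K))
    = f (real i / real K) + (f (real i / real K + 1 / real K) - f (real i / real K)) / (1 / real K) * (x - real i / real K)"
proof (induction i)
  case 0
  then show ?case by (simp add: interp_weight_def)
next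
  case (Suc i)
  have *: "real i / real K + 1 / real K = real (Suc i) / real K"
    by (simp add: add_divide_distrib)
  have **: "real (Suc i) / real K - 1 / real K = real i / real K"
    by (simp add: add_divide_distrib)
  have "f 0 + (\<Sum>j\<le>Suc i. interp_weight f K j * (x - real j / real K))
      = f 0 + (\<Sum>j\<le>i. interp_weight f K j * (x - real j / real K))
        + interp_weight f K (Suc i) * (x - real (Suc i) / real K)" by simp
  also have "\<dots> = f (real i / real K) + (f (real (Suc i) / real K) - f (real i / real K)) * real K * (x - real i / real K)
      + real K * (f (real (Suc i) / real K + 1 / real K) - 2 * f (real (Suc i) / real K) + f (real i / real K))
         * (x - real (Suc i) / real K)"
    unfolding Suc.IH unfolding interp_weight_def * ** by simp
  also have "\<dots> = f (real (Suc i) / real K) + (f (real (Suc i) / real K + 1 / real K) - f (real (Suc i) / real K))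
      / (1 / real K) * (x - real (Suc i) / real K)"
  proof -
    have e: "x - real i / real K = (x - real (Suc i) / real K) + 1 / real K" using * by simp
    \<comment> \<open>\<open>A\<close>, \<open>B\<close>, \<open>C\<close> stand for the values at
      three consecutive knots, \<open>k\<close> for the number of cells and \<open>y\<close> for the
      offset from the middle knot.\<close>
    have gen: "A + (B - A) * k * (y + 1 / k) + k * (C - 2 * B + A) * y = B + (C - B) / (1 / k) * y"
      if "k \<noteq> 0" for A B C k y :: real
      using that by (simp add: field_simps)
    show ?thesis unfolding e by (rule gen) (use K in simp)
  qed
  finally show ?case .
qed

lemma interpolation_error:
  assumes f: "f \<in> holder_ball \<beta> L" and \<beta>: "0 < \<beta>" "\<beta> \<le> 2" and L: "0 < L" and K: "0 < K"
    and x: "x \<in> {0..1}"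
  shows "\<bar>f 0 + (\<Sum>j<K. interp_weight f K j * max (x - real j / real K) 0) - f x\<bar> \<le> L * (1 / real K) powr \<beta>"
proof -
  obtain i where i: "i < K" "real i / real K \<le> x" "x \<le> real i / real K + 1 / real K"
  proof (cases "x = 1")
    \<comment> \<open>At \<open>x = 1\<close> the floor of \<open>K * x\<close> is \<open>K\<close>,
      which is no cell, so the last cell is taken instead.\<close>
    case True
    then show ?thesis using K that[of "K - 1"] by (simp add: of_nat_diff field_simps)
  next
    case False
    define i where "i = nat \<lfloor>real K * x\<rfloor>"
    have "real i \<le> real K * x" "real K * x < real i + 1"
      using x by (auto simp: i_def of_nat_nat)
    moreover have "real K * x < real K" using False x K by simp
    ultimately have "real i < real K" by linarith
    moreover have "real i / real K \<le> x" "x \<le> real i / real K + 1 / real K"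
      using K \<open>real i \<le> real K * x\<close> \<open>real K * x < real i + 1\<close> by (auto simp: field_simps)
    ultimately show ?thesis using that[of i] by simp
  qed
  have "(\<Sum>j<K. interp_weight f K j * max (x - real j / real K) 0)
      = (\<Sum>j\<le>i. interp_weight f K j * (x - real j / real K))"
  proof (rule sum.mono_neutral_cong_right)
    show "\<forall>j\<in>{..<K} - {..i}. interp_weight f K j * max (x - real j / real K) 0 = 0"
    proof
      fix j assume "j \<in> {..<K} - {..i}"
      then have "real (i + 1) \<le> real j" by (subst of_nat_le_iff) auto
      then have "real i / real K + 1 / real K \<le> real j / real K"
        using K by (simp add: divide_right_mono flip: add_divide_distrib)
      then show "interp_weight f K j * max (x - real j / real K) 0 = 0" using i(3) by simp
    qed
    show "interp_weight f K j * max (x - real j / real K) 0 = interp_weight f K j * (x - real j / real K)"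
      if "j \<in> {..i}" for j
    proof -
      have "real j / real K \<le> real i / real K" using that K by (simp add: divide_right_mono)
      then show ?thesis using i(2) by simp
    qed
  qed (use i(1) in auto)
  then have "f 0 + (\<Sum>j<K. interp_weight f K j * max (x - real j / real K) 0)
     = f (real i / real K) + (f (real i / real K + 1 / real K) - f (real i / real K)) / (1 / real K) * (x - real i / real K)"
    using interpolant_on_cell[OF K, where f = f and i = i and x = x] by simp
  moreover have "real i / real K + 1 / real K \<le> 1"
    using i(1) K by (simp add: field_simps flip: of_nat_Suc)
  ultimately show ?thesis
    using linear_interpolation_error[OF f \<beta> L, of "1 / real K" "real i / real K" x] i K by simp
qed

text \<open>Slope changes are \<open>K\<close> times a second difference and scale like
  \<open>K powr (1 - \<beta>)\<close>. The initial slope scales like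
  \<open>K powr (1 - min \<beta> 1)\<close>, which is 1 for \<open>\<beta> > 1\<close>; this is the
  extra unit at \<open>j = 0\<close>.\<close>

lemma interp_weight_bound:
  assumes f: "f \<in> holder_ball \<beta> L" and \<beta>: "0 < \<beta>" "\<beta> \<le> 2" and L: "0 < L" and j: "j < K"
  shows "\<bar>interp_weight f K j\<bar> \<le> 2 * L * (real K powr (1 - \<beta>) + (if j = 0 then 1 else 0))"
proof -
  have K: "0 < K" using j by simp
  have K': "real K * (1 / real K) powr b = real K powr (1 - b)" for b
    using K by (simp add: powr_divide powr_diff powr_one)
  show ?thesis
  proof (cases "j = 0")
    case True
    have "\<bar>interp_weight f K j\<bar> = real K * \<bar>f (0 + 1 / real K) - f 0\<bar>"
      using True by (simp add: interp_weight_def abs_mult)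
    also have "\<dots> \<le> real K * (L * (1 / real K) powr min \<beta> 1)"
      using K by (intro mult_left_mono first_difference_bound[OF f \<beta> L]) auto
    also have "\<dots> = L * real K powr (1 - min \<beta> 1)"
      using K'[of "min \<beta> 1"] by (simp add: mult.left_commute)
    also have "real K powr (1 - min \<beta> 1) \<le> real K powr (1 - \<beta>) + 1"
      using K by (auto simp: min_def)
    also have "L * (real K powr (1 - \<beta>) + 1) \<le> 2 * (L * (real K powr (1 - \<beta>) + 1))"
      using L by (intro order_trans[OF _ eq_refl[OF mult_2[symmetric]]]) auto
    finally show ?thesis using True L by simp
  next
    case False
    have "real (j + 1) \<le> real K" using j by (subst of_nat_le_iff) simp
    then have le: "real j / real K + 1 / real K \<le> 1" using K by (simp flip: add_divide_distrib)
    have ge: "0 \<le> real j / real K - 1 / real K"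
      using False K by (simp flip: diff_divide_distrib)
    have "\<bar>interp_weight f K j\<bar> = real K * \<bar>f (real j / real K + 1 / real K) - 2 * f (real j / real K) + f (real j / real K - 1 / real K)\<bar>"
      using False by (simp add: interp_weight_def abs_mult)
    also have "\<dots> \<le> real K * (2 * L * (1 / real K) powr \<beta>)"
      using K le ge by (intro mult_left_mono second_difference_bound[OF f \<beta> L]) auto
    also have "\<dots> = 2 * L * real K powr (1 - \<beta>)"
      using K'[of \<beta>] by (simp add: mult.left_commute)
    finally show ?thesis using False by simp
  qed
qed

lemma sum_over_multiples:
  fixes \<phi> :: "nat \<Rightarrow> real"
  assumes "0 < m"
  shows "(\<Sum>k<m * K. if m dvd k then \<phi> (k div m) else 0) = (\<Sum>j<K. \<phi> j)"
proof -
  have "(\<Sum>k<m * K. if m dvd k then \<phi> (k div m) else 0) = (\<Sum>k\<in>{k\<in>{..<m * K}. m dvd k}. \<phi> (k div m))"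
    by (rule sum.inter_filter[symmetric]) simp
  also have "\<dots> = (\<Sum>j<K. \<phi> j)"
    using assms by (intro sum.reindex_bij_witness[of _ "\<lambda>j. m * j" "\<lambda>k. k div m"]) auto
  finally show ?thesis .
qed

text \<open>The knot \<open>k / (m * K)\<close> lies on the coarse grid exactly when
  \<open>m\<close> divides \<open>k\<close>. Zero weights elsewhere let the wide network reproduce
  the coarse interpolant.\<close>

definition embed_weight :: "(real \<Rightarrow> real) \<Rightarrow> nat \<Rightarrow> nat \<Rightarrow> nat \<Rightarrow> real" where
  "embed_weight f K m k = (if m dvd k then interp_weight f K (k div m) else 0)"

lemma relu_net_interpolates:
  assumes f: "f \<in> holder_ball \<beta> L" and \<beta>: "0 < \<beta>" "\<beta> \<le> 2" and L: "0 < L" and K: "0 < K"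
    and m: "0 < m" and x: "x \<in> {0..1}"
  shows "\<bar>relu_net (m * K) (embed_weight f K m) (f 0) x - f x\<bar> \<le> L * (1 / real K) powr \<beta>"
proof -
  have "(\<Sum>k<m * K. embed_weight f K m k * max (x - real k / real (m * K)) 0)
      = (\<Sum>k<m * K. if m dvd k then interp_weight f K (k div m) * max (x - real (k div m) / real K) 0 else 0)"
    using m by (intro sum.cong) (auto simp: embed_weight_def elim!: dvdE)
  also have "\<dots> = (\<Sum>j<K. interp_weight f K j * max (x - real j / real K) 0)"
    by (rule sum_over_multiples[OF m])
  finally have "relu_net (m * K) (embed_weight f K m) (f 0) x
      = f 0 + (\<Sum>j<K. interp_weight f K j * max (x - real j / real K) 0)"
    using x by (simp add: relu_net_def)
  then show ?thesis using interpolation_error[OF f \<beta> L K x] by simp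
qed

text \<open>On the unit interval every hinge function takes values between 0 and 1, so the errors of
  the weights simply add up.\<close>

lemma relu_net_perturbation:
  assumes w: "\<And>k. k < N \<Longrightarrow> \<bar>w k - v k\<bar> \<le> d" and b: "\<bar>b - c\<bar> \<le> e" and x: "x \<in> {0..1}"
  shows "\<bar>relu_net N w b x - relu_net N v c x\<bar> \<le> real N * d + e"
proof -
  have "\<bar>(\<Sum>k<N. (w k - v k) * max (x - real k / real N) 0)\<bar> \<le> (\<Sum>k<N. d * 1)"
  proof (intro order_trans[OF sum_abs] sum_mono)
    fix k assume "k \<in> {..<N}"
    then have wk: "\<bar>w k - v k\<bar> \<le> d" using w by simp
    have "0 \<le> real k / real N" by simp
    then have "x - real k / real N \<le> 1" using x unfolding atLeastAtMost_iff by linarith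
    then have "\<bar>w k - v k\<bar> * max (x - real k / real N) 0 \<le> d * 1"
      using wk by (intro mult_mono) auto
    then show "\<bar>(w k - v k) * max (x - real k / real N) 0\<bar> \<le> d * 1" by (simp add: abs_mult)
  qed
  moreover have "relu_net N w b x - relu_net N v c x = (\<Sum>k<N. (w k - v k) * max (x - real k / real N) 0) + (b - c)"
    using x by (simp add: relu_net_def algebra_simps sum_subtractf)
  ultimately show ?thesis using b by simp
qed

section \<open>Prior mass\<close>

lemma powr_add_le:
  fixes u v p :: real
  assumes "0 \<le> u" "0 \<le> v" "0 < p" "p \<le> 1"
  shows "(u + v) powr p \<le> 2 * (u powr p + v powr p)"
proof -
  have "(u + v) powr p \<le> (2 * max u v) powr p" using assms by (intro powr_mono2) auto
  also have "\<dots> = 2 powr p * max u v powr p" using assms by (simp add: powr_mult)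
  also have "\<dots> \<le> 2 powr 1 * max u v powr p" using assms by (intro mult_right_mono powr_mono) auto
  also have "max u v powr p \<le> u powr p + v powr p" by (simp add: max_def)
  finally show ?thesis by simp
qed

section \<open>Small-ball probabilities of a single weight and of the bias\<close>

context
  fixes h :: "real \<Rightarrow> real"
  assumes h: "prob_density h"
begin

lemma prob_density_measurable [measurable]: "h \<in> borel_measurable borel"
  using h by (simp add: prob_density_def)

lemma prob_density_nonneg: "0 \<le> h t"
  using h by (simp add: prob_density_def)

lemma prob_density_prob_space: "prob_space (density lborel (\<lambda>t. ennreal (h t)))"
  using h by (simp add: prob_density_def)

lemma measure_interval_ge:
  assumes "a \<le> b" "0 \<le> c" "\<And>t. a \<le> t \<Longrightarrow> t \<le> b \<Longrightarrow> c \<le> h t"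
  shows "c * (b - a) \<le> measure (density lborel (\<lambda>t. ennreal (h t))) {a..b}"
proof -
  interpret prob_space "density lborel (\<lambda>t. ennreal (h t))" by (rule prob_density_prob_space)
  have "ennreal (c * (b - a)) = (\<integral>\<^sup>+t. ennreal c * indicator {a..b} t \<partial>lborel)"
    using assms by (simp add: nn_integral_cmult_indicator ennreal_mult)
  also have "\<dots> \<le> (\<integral>\<^sup>+t. ennreal (h t) * indicator {a..b} t \<partial>lborel)"
    using assms by (intro nn_integral_mono) (auto simp: indicator_def ennreal_leI)
  also have "\<dots> = ennreal (prob {a..b})"
    by (simp add: emeasure_density flip: emeasure_eq_measure)
  finally show ?thesis by (simp add: ennreal_le_iff)
qed

lemma measure_upper_tail:
  "measure (density lborel (\<lambda>t. ennreal (h t))) {x..} = (LINT t:{x..}|lborel. h t)"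
proof -
  have "(\<integral>\<^sup>+t. ennreal (h t) * indicator {x..} t \<partial>lborel) = (\<integral>\<^sup>+t. ennreal (indicator {x..} t *\<^sub>R h t) \<partial>lborel)"
    by (intro nn_integral_cong) (auto simp: indicator_def)
  then show ?thesis
    unfolding set_lebesgue_integral_def
    by (subst integral_eq_nn_integral) (auto simp: prob_density_nonneg measure_def emeasure_density)
qed

lemma measure_lower_tail:
  assumes "\<And>t. h (- t) = h t"
  shows "measure (density lborel (\<lambda>t. ennreal (h t))) {..- x} = measure (density lborel (\<lambda>t. ennreal (h t))) {x..}"
proof -
  have "(\<integral>\<^sup>+t. ennreal (h t) * indicator {..- x} t \<partial>lborel)
      = (\<integral>\<^sup>+t. ennreal (h (- t)) * indicator {..- x} (- t) \<partial>lborel)"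
    using nn_integral_real_affine[of "\<lambda>t. ennreal (h t) * indicator {..- x} t" "-1" 0] by simp
  also have "\<dots> = (\<integral>\<^sup>+t. ennreal (h t) * indicator {x..} t \<partial>lborel)"
    by (intro nn_integral_cong) (auto simp: assms indicator_def)
  finally show ?thesis by (simp add: measure_def emeasure_density)
qed

lemma measure_centered_interval:
  assumes "\<And>t. h (- t) = h t"
  shows "1 - 2 * (LINT t:{x..}|lborel. h t) \<le> measure (density lborel (\<lambda>t. ennreal (h t))) {- x..x}"
proof -
  interpret prob_space "density lborel (\<lambda>t. ennreal (h t))" by (rule prob_density_prob_space)
  have "1 = prob ({- x..x} \<union> ({x..} \<union> {..- x}))"
    using prob_space by (intro trans[OF prob_space[symmetric]] arg_cong[where f = prob]) auto
  also have "\<dots> \<le> prob {- x..x} + (prob {x..} + prob {..- x})"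
    by (intro order_trans[OF measure_Un_le] add_left_mono measure_Un_le) auto
  finally show ?thesis using measure_upper_tail[of x] measure_lower_tail[OF assms, of x] by simp
qed

text \<open>The two kinds of weights need two estimates. A window of radius 1 around an arbitrary
  \<open>u\<close> serves the coarse knots and is paid for by the lower bound on the density; a
  window around 0 serves all other weights, and by the tail bound a power of a logarithm suffices
  for its radius.\<close>

lemma weight_small_ball:
  assumes tails: "p_exponential_tails p q h" and p: "0 < p" "p \<le> 1"
  obtains B \<kappa> x\<^sub>0 where "0 < B" "0 < \<kappa>" "1 \<le> x\<^sub>0"
    and "\<And>u. exp (- B - B * \<bar>u\<bar> powr p) \<le> measure (density lborel (\<lambda>t. ennreal (h t))) {u - 1..u + 1}"
    and "\<And>x \<tau>. x\<^sub>0 \<le> x \<Longrightarrow> \<kappa> * ln x powr (1 / q) \<le> \<tau> \<Longrightarrow>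
      1 - 1 / x \<le> measure (density lborel (\<lambda>t. ennreal (h t))) {- \<tau>..\<tau>}"
proof -
  obtain c\<^sub>0 c\<^sub>1 where c: "0 < c\<^sub>0" "0 < c\<^sub>1" and lower: "\<And>t. 0 \<le> t \<Longrightarrow> c\<^sub>0 * exp (- c\<^sub>1 * t powr p) \<le> h t"
    using tails unfolding p_exponential_tails_def by blast
  obtain d\<^sub>0 d\<^sub>1 M\<^sub>0 where d: "0 < d\<^sub>0" "0 < d\<^sub>1" "0 < M\<^sub>0"
    and upper: "\<And>x. M\<^sub>0 \<le> x \<Longrightarrow> (LINT t:{x..}|lborel. h t) \<le> d\<^sub>0 * exp (- d\<^sub>1 * x powr q)"
    using tails unfolding p_exponential_tails_def by blast
  have q: "0 < q" and sym: "\<And>t. h (- t) = h t"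
    using tails unfolding p_exponential_tails_def by auto
  \<comment> \<open>The factor 2 comes from splitting the power of \<open>\<bar>u\<bar> + 1\<close>,
    and the second summand pays for the constant \<open>c\<^sub>0\<close>.\<close>
  define B where "B = 2 * c\<^sub>1 + \<bar>ln c\<^sub>0\<bar>"
  \<comment> \<open>Beyond \<open>\<kappa> * ln x powr (1 / q)\<close> the tail is at most
    \<open>d\<^sub>0 / x\<^sup>2\<close>. One of the two factors \<open>x\<close> absorbs
    \<open>2 * d\<^sub>0\<close>, whence the threshold \<open>2 * d\<^sub>0\<close> below.\<close>
  define \<kappa> where "\<kappa> = (2 / d\<^sub>1) powr (1 / q)"
  have \<kappa>: "0 < \<kappa>" using d by (simp add: \<kappa>_def)
  have "\<forall>\<^sub>F x in at_top. M\<^sub>0 \<le> \<kappa> * ln x powr (1 / q)"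
    using \<kappa> q d by real_asymp
  then obtain x\<^sub>1 where x1: "\<And>x. x\<^sub>1 \<le> x \<Longrightarrow> M\<^sub>0 \<le> \<kappa> * ln x powr (1 / q)"
    unfolding eventually_at_top_linorder by blast
  show thesis
  proof (rule that[of B \<kappa> "max x\<^sub>1 (max 1 (2 * d\<^sub>0))"])
    show "exp (- B - B * \<bar>u\<bar> powr p) \<le> measure (density lborel (\<lambda>t. ennreal (h t))) {u - 1..u + 1}" for u
    proof -
      define c where "c = c\<^sub>0 * exp (- c\<^sub>1 * (2 * (\<bar>u\<bar> powr p + 1)))"
      have "c \<le> h t" if "u - 1 \<le> t" "t \<le> u + 1" for t
      proof -
        have "\<bar>t\<bar> powr p \<le> (\<bar>u\<bar> + 1) powr p" using that p by (intro powr_mono2) auto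
        also have "\<dots> \<le> 2 * (\<bar>u\<bar> powr p + 1)" using powr_add_le[of "\<bar>u\<bar>" 1 p] p by simp
        finally have "c \<le> c\<^sub>0 * exp (- c\<^sub>1 * \<bar>t\<bar> powr p)" using c by (simp add: c_def)
        also have "\<dots> \<le> h \<bar>t\<bar>" by (rule lower) simp
        also have "\<dots> = h t" using sym[of t] by (simp add: abs_if)
        finally show ?thesis .
      qed
      then have "c * ((u + 1) - (u - 1)) \<le> measure (density lborel (\<lambda>t. ennreal (h t))) {u - 1..u + 1}"
        using c by (intro measure_interval_ge) (auto simp: c_def)
      moreover have "exp (- B - B * \<bar>u\<bar> powr p) \<le> c"
      proof -
        have "B + B * \<bar>u\<bar> powr p \<ge> - ln c\<^sub>0 + c\<^sub>1 * (2 * (\<bar>u\<bar> powr p + 1))"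
        proof -
          have "0 \<le> \<bar>ln c\<^sub>0\<bar> * \<bar>u\<bar> powr p" by simp
          moreover have "B * \<bar>u\<bar> powr p = 2 * c\<^sub>1 * \<bar>u\<bar> powr p + \<bar>ln c\<^sub>0\<bar> * \<bar>u\<bar> powr p"
            by (simp add: B_def algebra_simps)
          moreover have "c\<^sub>1 * (2 * (\<bar>u\<bar> powr p + 1)) = 2 * c\<^sub>1 * \<bar>u\<bar> powr p + 2 * c\<^sub>1"
            by (simp add: algebra_simps)
          moreover have "B = 2 * c\<^sub>1 + \<bar>ln c\<^sub>0\<bar>" by (rule B_def)
          ultimately show ?thesis by linarith
        qed
        then have "exp (- B - B * \<bar>u\<bar> powr p) \<le> exp (ln c\<^sub>0 - c\<^sub>1 * (2 * (\<bar>u\<bar> powr p + 1)))" by simp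
        also have "\<dots> = c" using c by (simp add: c_def exp_diff exp_minus divide_inverse)
        finally show ?thesis .
      qed
      moreover have "0 < c" using c by (simp add: c_def)
      ultimately show ?thesis by simp
    qed
    show "1 - 1 / x \<le> measure (density lborel (\<lambda>t. ennreal (h t))) {- \<tau>..\<tau>}"
      if x: "max x\<^sub>1 (max 1 (2 * d\<^sub>0)) \<le> x" and \<tau>: "\<kappa> * ln x powr (1 / q) \<le> \<tau>" for x \<tau>
    proof -
      have ln: "0 \<le> ln x" using x by simp
      have M: "M\<^sub>0 \<le> \<tau>" using x1[of x] x \<tau> by simp
      have "2 / d\<^sub>1 * ln x = (\<kappa> * ln x powr (1 / q)) powr q"
        using q d ln by (simp add: \<kappa>_def powr_mult powr_powr)
      also have "\<dots> \<le> \<tau> powr q" using \<tau> q \<kappa> by (intro powr_mono2) auto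
      finally have "2 * ln x \<le> d\<^sub>1 * \<tau> powr q" using d by (simp add: field_simps)
      then have "2 * (LINT t:{\<tau>..}|lborel. h t) \<le> 2 * (d\<^sub>0 * exp (- (2 * ln x)))"
        using upper[OF M] d by (intro mult_left_mono order_trans[OF upper[OF M]]) auto
      also have "exp (- (2 * ln x)) = 1 / x\<^sup>2"
        using x by (simp add: exp_minus exp_double inverse_eq_divide)
      also have "2 * (d\<^sub>0 * (1 / x\<^sup>2)) \<le> 1 / x"
        using x by (simp add: field_simps power2_eq_square)
      finally show ?thesis using measure_centered_interval[OF sym, of \<tau>] by linarith
    qed
  qed (use c \<kappa> in \<open>auto simp: B_def\<close>)
qed

end

text \<open>A continuous positive density attains a positive minimum on a compact interval that
  contains every admissible window.\<close>

lemma bias_small_ball: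
  assumes g: "prob_density g" "continuous_on UNIV g" "\<forall>t. 0 < g t"
  obtains \<gamma> where "0 < \<gamma>"
    and "\<And>b e. \<bar>b\<bar> \<le> F \<Longrightarrow> 0 < e \<Longrightarrow> e \<le> 1 \<Longrightarrow>
      \<gamma> * e \<le> measure (density lborel (\<lambda>t. ennreal (g t))) {b - e..b + e}"
proof -
  let ?S = "{- \<bar>F\<bar> - 1..\<bar>F\<bar> + 1}"
  have "?S \<noteq> {}" by simp
  then obtain s where s: "s \<in> ?S" "\<forall>t\<in>?S. g s \<le> g t"
    using continuous_attains_inf[OF compact_Icc _ continuous_on_subset[OF g(2) subset_UNIV]] by blast
  define \<gamma> where "\<gamma> = g s"
  have \<gamma>: "0 < \<gamma>" "\<And>t. t \<in> ?S \<Longrightarrow> \<gamma> \<le> g t" using s g(3) by (auto simp: \<gamma>_def)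
  show thesis
  proof (rule that[of \<gamma>])
    fix b e :: real assume be: "\<bar>b\<bar> \<le> F" "0 < e" "e \<le> 1"
    have "\<gamma> * ((b + e) - (b - e)) \<le> measure (density lborel (\<lambda>t. ennreal (g t))) {b - e..b + e}"
    proof (rule measure_interval_ge[OF g(1)])
      show "\<gamma> \<le> g t" if "b - e \<le> t" "t \<le> b + e" for t
        using that be by (intro \<gamma>(2)) auto
    qed (use be \<gamma>(1) in auto)
    moreover have "\<gamma> * e \<le> \<gamma> * ((b + e) - (b - e))" using \<gamma>(1) be by (intro mult_left_mono) auto
    ultimately show "\<gamma> * e \<le> measure (density lborel (\<lambda>t. ennreal (g t))) {b - e..b + e}" by linarith
  qed (rule \<gamma>(1))
qed

text \<open>This sum is the cost of the coarse weights in the exponent of the prior mass. The extra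
  unit from the initial slope occurs once and is absorbed because
  \<open>p * (\<beta> - 1) \<le> 1\<close> makes the exponent of \<open>K\<close>
  non-negative.\<close>

lemma interp_weight_powr_sum:
  assumes f: "f \<in> holder_ball \<beta> L" and \<beta>: "0 < \<beta>" "\<beta> \<le> 2" and L: "0 < L" and K: "0 < K"
    and p: "0 < p" "p \<le> 1" and \<sigma>: "0 < \<sigma>"
  shows "(\<Sum>j<K. \<bar>interp_weight f K j / \<sigma>\<bar> powr p)
    \<le> 4 * (2 * L) powr p * (real K powr (1 + p * (1 - \<beta>)) * \<sigma> powr (- p))"
proof -
  define a where "a = real K powr (1 - \<beta>)"
  have le1: "1 \<le> real K powr (1 + p * (1 - \<beta>))"
  proof -
    have "p * (\<beta> - 1) \<le> 1"
    proof (cases "1 \<le> \<beta>")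
      case True
      then show ?thesis using mult_mono[of p 1 "\<beta> - 1" 1] p \<beta> by simp
    next
      case False
      then show ?thesis using mult_nonneg_nonpos[of p "\<beta> - 1"] p by simp
    qed
    then show ?thesis using K by (intro ge_one_powr_ge_zero) (auto simp: algebra_simps)
  qed
  have "\<bar>interp_weight f K j / \<sigma>\<bar> powr p \<le> (2 * L / \<sigma>) powr p * (2 * (a powr p + (if j = 0 then 1 else 0)))"
    if j: "j < K" for j
  proof -
    let ?i = "if j = 0 then 1 else 0 :: real"
    have "\<bar>interp_weight f K j / \<sigma>\<bar> \<le> 2 * L / \<sigma> * (a + ?i)"
      using interp_weight_bound[OF f \<beta> L j] \<sigma> by (simp add: a_def divide_right_mono abs_divide split: if_splits)
    then have "\<bar>interp_weight f K j / \<sigma>\<bar> powr p \<le> (2 * L / \<sigma> * (a + ?i)) powr p"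
      using p by (intro powr_mono2) auto
    also have "\<dots> = (2 * L / \<sigma>) powr p * (a + ?i) powr p"
      by (rule powr_mult)
    also have "(a + ?i) powr p \<le> 2 * (a powr p + ?i powr p)"
      using p by (intro powr_add_le) (auto simp: a_def)
    also have "?i powr p = ?i" by simp
    finally show ?thesis by (simp add: mult_left_mono)
  qed
  then have "(\<Sum>j<K. \<bar>interp_weight f K j / \<sigma>\<bar> powr p)
      \<le> (\<Sum>j<K. (2 * L / \<sigma>) powr p * (2 * (a powr p + (if j = 0 then 1 else 0))))"
    by (intro sum_mono) auto
  also have "\<dots> = (2 * L / \<sigma>) powr p * (2 * (real K * a powr p + 1))"
    using K by (simp add: sum.distrib flip: sum_distrib_left)
  also have "real K * a powr p = real K powr (1 + p * (1 - \<beta>))"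
    using K by (simp add: a_def powr_powr powr_add mult.commute)
  also have "(2 * L / \<sigma>) powr p * (2 * (real K powr (1 + p * (1 - \<beta>)) + 1))
      \<le> (2 * L / \<sigma>) powr p * (4 * real K powr (1 + p * (1 - \<beta>)))"
    using le1 by (intro mult_left_mono) auto
  also have "(2 * L / \<sigma>) powr p = (2 * L) powr p * \<sigma> powr (- p)"
    using L \<sigma> by (simp add: powr_divide powr_minus_divide)
  finally show ?thesis by (simp only: mult_ac)
qed

section \<open>The parameter space of the network and the mass of its boxes\<close>

abbreviation net_param :: "nat \<Rightarrow> (real \<Rightarrow> real) \<Rightarrow> (real \<Rightarrow> real) \<Rightarrow> ((nat \<Rightarrow> real) \<times> real) measure" where
  "net_param N h g \<equiv> (\<Pi>\<^sub>M k\<in>{..<N}. density lborel (\<lambda>t. ennreal (h t))) \<Otimes>\<^sub>M density lborel (\<lambda>t. ennreal (g t))"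

lemma prob_space_net_param:
  assumes "prob_density h" "prob_density g"
  shows "prob_space (net_param N h g)"
proof -
  interpret W: prob_space "\<Pi>\<^sub>M k\<in>{..<N}. density lborel (\<lambda>t. ennreal (h t))"
    by (intro prob_space_PiM prob_density_prob_space assms)
  interpret b: prob_space "density lborel (\<lambda>t. ennreal (g t))"
    by (intro prob_density_prob_space assms)
  interpret Wb: pair_prob_space "\<Pi>\<^sub>M k\<in>{..<N}. density lborel (\<lambda>t. ennreal (h t))" "density lborel (\<lambda>t. ennreal (g t))" ..
  show ?thesis by (rule Wb.P.prob_space_axioms)
qed

lemma sets_net_param: "sets (net_param N h g) = sets ((\<Pi>\<^sub>M k\<in>{..<N}. borel) \<Otimes>\<^sub>M borel)"
  by (intro sets_pair_measure_cong sets_PiM_cong) auto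

lemma relu_net_jointly_measurable:
  assumes PX: "design_distribution PX"
  shows "(\<lambda>(\<theta>, x). (case \<theta> of (\<zeta>, b) \<Rightarrow> relu_net N (\<lambda>k. \<sigma> * \<zeta> k) b) x)
    \<in> borel_measurable (net_param N h g \<Otimes>\<^sub>M PX)"
proof -
  let ?M = "((\<Pi>\<^sub>M k\<in>{..<N}. borel :: real measure) \<Otimes>\<^sub>M (borel :: real measure)) \<Otimes>\<^sub>M (restrict_space borel {0..1::real})"
  have sets: "sets (net_param N h g \<Otimes>\<^sub>M PX) = sets ?M"
    using PX by (intro sets_pair_measure_cong sets_net_param) (simp add: design_distribution_def)
  have [measurable]: "(\<lambda>z. snd z) \<in> borel_measurable ?M"
    by (rule measurable_compose[OF measurable_snd]) (simp add: measurable_restrict_space1)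
  have "(\<lambda>z. (\<Sum>k<N. \<sigma> * fst (fst z) k * max (snd z - real k / real N) 0) + snd (fst z)) \<in> borel_measurable ?M"
    by measurable
  then have "(\<lambda>(\<theta>, x). (case \<theta> of (\<zeta>, b) \<Rightarrow> relu_net N (\<lambda>k. \<sigma> * \<zeta> k) b) x) \<in> borel_measurable ?M"
    by (rule measurable_cong[THEN iffD1, rotated])
      (auto simp: relu_net_def space_pair_measure space_restrict_space)
  then show ?thesis unfolding measurable_cong_sets[OF sets refl] .
qed

lemma relu_net_measurable_C01:
  "(\<lambda>(\<zeta>, b). relu_net N (\<lambda>k. \<sigma> * \<zeta> k) b) \<in> measurable (net_param N h g) C01"
  unfolding C01_def
proof (rule measurable_restrict_space2)
  show "(\<lambda>(\<zeta>, b). relu_net N (\<lambda>k. \<sigma> * \<zeta> k) b) \<in> space (net_param N h g) \<rightarrow> {f. continuous_on {0..1} f}"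
  proof (clarsimp)
    fix \<zeta> b
    have "continuous_on {0..1} (\<lambda>x. (\<Sum>k<N. \<sigma> * \<zeta> k * max (x - real k / real N) 0) + b)"
      by (intro continuous_intros)
    then show "continuous_on {0..1} (relu_net N (\<lambda>k. \<sigma> * \<zeta> k) b)"
      by (rule continuous_on_eq) (simp add: relu_net_def)
  qed
  have "(\<lambda>\<theta>. \<lambda>x\<in>{0..1}. (\<Sum>k<N. \<sigma> * fst \<theta> k * max (x - real k / real N) 0) + snd \<theta>)
      \<in> measurable ((\<Pi>\<^sub>M k\<in>{..<N}. borel) \<Otimes>\<^sub>M borel) (\<Pi>\<^sub>M x\<in>{0..1::real}. borel)"
    by (intro measurable_restrict) measurable
  then show "(\<lambda>(\<zeta>, b). relu_net N (\<lambda>k. \<sigma> * \<zeta> k) b) \<in> measurable (net_param N h g) (\<Pi>\<^sub>M x\<in>{0..1}. borel)"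
    unfolding measurable_cong_sets[OF sets_net_param refl] by (simp add: relu_net_def case_prod_beta')
qed

lemma measure_net_param_box:
  assumes h: "prob_density h" and g: "prob_density g"
    and I: "\<And>k. k < N \<Longrightarrow> I k \<in> sets borel" and J: "J \<in> sets borel"
  shows "(\<Pi>\<^sub>E k\<in>{..<N}. I k) \<times> J \<in> sets (net_param N h g)"
    and "measure (net_param N h g) ((\<Pi>\<^sub>E k\<in>{..<N}. I k) \<times> J)
      = (\<Prod>k<N. measure (density lborel (\<lambda>t. ennreal (h t))) (I k)) * measure (density lborel (\<lambda>t. ennreal (g t))) J"
proof -
  interpret h: prob_space "density lborel (\<lambda>t. ennreal (h t))" by (rule prob_density_prob_space[OF h])
  interpret g: prob_space "density lborel (\<lambda>t. ennreal (g t))" by (rule prob_density_prob_space[OF g])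
  interpret W: finite_product_prob_space "\<lambda>_. density lborel (\<lambda>t. ennreal (h t))" "{..<N}"
    by unfold_locales auto
  have box: "(\<Pi>\<^sub>E k\<in>{..<N}. I k) \<in> sets (\<Pi>\<^sub>M k\<in>{..<N}. density lborel (\<lambda>t. ennreal (h t)))"
    using I by (intro sets_PiM_I_finite) auto
  then show "(\<Pi>\<^sub>E k\<in>{..<N}. I k) \<times> J \<in> sets (net_param N h g)"
    using J by (intro pair_measureI) auto
  have "emeasure (net_param N h g) ((\<Pi>\<^sub>E k\<in>{..<N}. I k) \<times> J)
      = emeasure (\<Pi>\<^sub>M k\<in>{..<N}. density lborel (\<lambda>t. ennreal (h t))) (\<Pi>\<^sub>E k\<in>{..<N}. I k)
        * emeasure (density lborel (\<lambda>t. ennreal (g t))) J"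
    using box J by (intro g.emeasure_pair_measure_Times) auto
  moreover have "W.prob (\<Pi>\<^sub>E k\<in>{..<N}. I k) = (\<Prod>k<N. h.prob (I k))"
    using I by (intro W.prob_times) auto
  ultimately show "measure (net_param N h g) ((\<Pi>\<^sub>E k\<in>{..<N}. I k) \<times> J)
      = (\<Prod>k<N. h.prob (I k)) * g.prob J"
    by (simp add: measure_def enn2real_mult)
qed

text \<open>The box has product mass. Off the coarse grid each factor is at least
  \<open>1 - 1 / x\<close>, hence at least \<open>exp (- 2 / x)\<close>, so these factors cost only
  a constant once \<open>x\<close> is of the order of the width; on the coarse grid the window
  shrinks to radius 1 and \<open>ball\<close> applies.\<close>

lemma prior_mass:
  assumes h: "prob_density h" and g: "prob_density g" and m: "0 < m" and x: "2 \<le> x"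
    and \<tau>: "1 \<le> \<tau>" and B: "0 < B"
    and ball: "\<And>u. exp (- B - B * \<bar>u\<bar> powr p) \<le> measure (density lborel (\<lambda>t. ennreal (h t))) {u - 1..u + 1}"
    and center: "1 - 1 / x \<le> measure (density lborel (\<lambda>t. ennreal (h t))) {- \<tau>..\<tau>}"
    and bias: "0 \<le> \<gamma>" "\<gamma> \<le> measure (density lborel (\<lambda>t. ennreal (g t))) {b - e..b + e}"
  shows "exp (- (2 * real (m * K) / x + real K * B + B * (\<Sum>j<K. \<bar>interp_weight f K j / \<sigma>\<bar> powr p))) * \<gamma>
    \<le> measure (net_param (m * K) h g)
        ((\<Pi>\<^sub>E k\<in>{..<m * K}. {embed_weight f K m k / \<sigma> - \<tau>..embed_weight f K m k / \<sigma> + \<tau>}) \<times> {b - e..b + e})"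
proof -
  let ?u = "\<lambda>k. embed_weight f K m k / \<sigma>"
  define s where "s k = (if m dvd k then B + B * \<bar>interp_weight f K (k div m) / \<sigma>\<bar> powr p else 0)" for k
  interpret prob_space "density lborel (\<lambda>t. ennreal (h t))" by (rule prob_density_prob_space[OF h])
  \<comment> \<open>Through \<open>exp (2 / x) \<ge> 1 + 2 / x\<close> this reduces to
    \<open>x / (x + 2) \<le> (x - 1) / x\<close>, which for positive \<open>x\<close> means
    \<open>x \<ge> 2\<close>.\<close>
  have x_exp: "exp (- (2 / x)) \<le> 1 - 1 / x"
  proof -
    have "exp (- (2 / x)) \<le> 1 / (1 + 2 / x)"
      unfolding exp_minus inverse_eq_divide
      using exp_ge_add_one_self[of "2 / x"] x by (intro divide_left_mono mult_pos_pos add_pos_pos) auto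
    also have "\<dots> \<le> 1 - 1 / x"
      using x by (simp add: field_simps)
    finally show ?thesis .
  qed
  \<comment> \<open>Charging \<open>2 / x\<close> to the coarse knots too only weakens the bound and
    keeps the total a single sum.\<close>
  have factor: "exp (- (2 / x + s k)) \<le> prob {?u k - \<tau>..?u k + \<tau>}" if "k < m * K" for k
  proof (cases "m dvd k")
    case True
    then have "exp (- (2 / x + s k)) \<le> exp (- B - B * \<bar>?u k\<bar> powr p)"
      using x by (simp add: s_def embed_weight_def)
    also have "\<dots> \<le> prob {?u k - 1..?u k + 1}" by (rule ball)
    also have "\<dots> \<le> prob {?u k - \<tau>..?u k + \<tau>}"
      using \<tau> by (intro finite_measure_mono) auto
    finally show ?thesis .
  next
    case False
    then show ?thesis using x_exp center by (simp add: s_def embed_weight_def)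
  qed
  have "(\<Sum>k<m * K. 2 / x + s k) = 2 * real (m * K) / x + (\<Sum>j<K. B + B * \<bar>interp_weight f K j / \<sigma>\<bar> powr p)"
    using sum_over_multiples[OF m, where \<phi> = "\<lambda>j. B + B * \<bar>interp_weight f K j / \<sigma>\<bar> powr p" and K = K]
    by (simp only: s_def sum.distrib sum_constant card_lessThan) simp
  also have "\<dots> = 2 * real (m * K) / x + real K * B + B * (\<Sum>j<K. \<bar>interp_weight f K j / \<sigma>\<bar> powr p)"
    by (simp add: sum.distrib sum_distrib_left)
  finally have "exp (- (2 * real (m * K) / x + real K * B + B * (\<Sum>j<K. \<bar>interp_weight f K j / \<sigma>\<bar> powr p)))
      = (\<Prod>k<m * K. exp (- (2 / x + s k)))"
    by (simp only: exp_sum[symmetric] finite_lessThan sum_negf)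
  also have "\<dots> \<le> (\<Prod>k<m * K. prob {?u k - \<tau>..?u k + \<tau>})"
    using factor by (intro prod_mono) auto
  finally show ?thesis
    unfolding measure_net_param_box(2)[OF h g, of "m * K" "\<lambda>k. {?u k - \<tau>..?u k + \<tau>}" "{b - e..b + e}", simplified]
    using bias by (intro mult_mono) (auto intro!: prod_nonneg)
qed

lemma relu_net_near_on_box:
  assumes f: "f \<in> holder_ball \<beta> L" and \<beta>: "0 < \<beta>" "\<beta> \<le> 2" and L: "0 < L" and K: "0 < K" and m: "0 < m"
    and \<sigma>: "0 < \<sigma>" and x: "x \<in> {0..1}"
    and \<zeta>: "\<zeta> \<in> (\<Pi>\<^sub>E k\<in>{..<m * K}. {embed_weight f K m k / \<sigma> - \<tau>..embed_weight f K m k / \<sigma> + \<tau>})"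
    and b: "b \<in> {f 0 - e..f 0 + e}"
  shows "\<bar>relu_net (m * K) (\<lambda>k. \<sigma> * \<zeta> k) b x - f x\<bar> \<le> L * (1 / real K) powr \<beta> + real (m * K) * (\<sigma> * \<tau>) + e"
proof -
  have "\<bar>\<sigma> * \<zeta> k - embed_weight f K m k\<bar> \<le> \<sigma> * \<tau>" if "k < m * K" for k
  proof -
    have "\<bar>\<zeta> k - embed_weight f K m k / \<sigma>\<bar> \<le> \<tau>"
      using PiE_mem[OF \<zeta>, of k] that by (auto simp: abs_le_iff)
    then have "\<sigma> * \<bar>\<zeta> k - embed_weight f K m k / \<sigma>\<bar> \<le> \<sigma> * \<tau>" using \<sigma> by (intro mult_left_mono) auto
    also have "\<sigma> * \<bar>\<zeta> k - embed_weight f K m k / \<sigma>\<bar> = \<bar>\<sigma> * (\<zeta> k - embed_weight f K m k / \<sigma>)\<bar>"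
      using \<sigma> by (simp add: abs_mult)
    also have "\<sigma> * (\<zeta> k - embed_weight f K m k / \<sigma>) = \<sigma> * \<zeta> k - embed_weight f K m k"
      using \<sigma> by (simp add: right_diff_distrib)
    finally show ?thesis .
  qed
  moreover have "\<bar>b - f 0\<bar> \<le> e" using b by (auto simp: abs_le_iff)
  ultimately have "\<bar>relu_net (m * K) (\<lambda>k. \<sigma> * \<zeta> k) b x - relu_net (m * K) (embed_weight f K m) (f 0) x\<bar>
      \<le> real (m * K) * (\<sigma> * \<tau>) + e"
    by (intro relu_net_perturbation x)
  with relu_net_interpolates[OF f \<beta> L K m x] show ?thesis by linarith
qed

section \<open>Rates\<close>

text \<open>Rounding moves the exponent of 2 by at most 1/2, so a factor 2 either way is ample; the
  exponent is non-negative, so \<open>nat\<close> does not truncate.\<close>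

lemma width_bounds:
  assumes n: "1 \<le> n" and s: "0 \<le> s"
  shows "real n powr (1 / (2 * s + 1)) / 2 \<le> real (width s n)"
    and "real (width s n) \<le> 2 * real n powr (1 / (2 * s + 1))"
proof -
  define x where "x = log 2 (real n) / (2 * s + 1)"
  have x: "0 \<le> x" using n s by (simp add: x_def)
  then have r: "0 \<le> round x" by (simp add: round_def)
  have "real (width s n) = 2 powr real (nat (round x))"
    by (simp add: width_def x_def powr_realpow)
  also have "real (nat (round x)) = of_int (round x)" using r by simp
  finally have w: "real (width s n) = 2 powr of_int (round x)" .
  have p: "2 powr x = real n powr (1 / (2 * s + 1))"
    using n powr_powr[of 2 "log 2 (real n)" "1 / (2 * s + 1)"] by (simp add: x_def)
  have "\<bar>of_int (round x) - x\<bar> \<le> 1 / 2" by (rule of_int_round_abs_le)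
  then have "x - 1 \<le> of_int (round x)" "of_int (round x) \<le> x + 1" by linarith+
  then have "2 powr (x - 1) \<le> 2 powr of_int (round x)" "2 powr of_int (round x) \<le> (2::real) powr (x + 1)"
    by (auto intro!: powr_mono)
  then show "real n powr (1 / (2 * s + 1)) / 2 \<le> real (width s n)"
    and "real (width s n) \<le> 2 * real n powr (1 / (2 * s + 1))"
    unfolding w p[symmetric] by (auto simp: powr_diff powr_add)
qed

lemma width_pos: "0 < width s n"
  by (simp add: width_def)

text \<open>Rounding is monotone and the exponent decreases in the smoothness, so the smaller power
  of two divides the larger.\<close>

lemma width_dvd:
  assumes "0 \<le> \<alpha>" "\<alpha> \<le> \<beta>" "1 \<le> n"
  shows "width \<beta> n dvd width \<alpha> n"
  unfolding width_def using assms
  by (intro le_imp_power_dvd nat_mono round_mono divide_left_mono mult_pos_pos) auto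

text \<open>All three rest on \<open>n * (eps_star \<beta> n)\<^sup>2\<close> being \<open>n\<close>
  to the power \<open>1 / (2 * \<beta> + 1)\<close>, the order of the coarse width. From
  \<open>\<beta> \<le> 2\<close> come the constant 4 and the exponent 1/5.\<close>

lemma eps_star_width:
  assumes n: "1 \<le> n" and \<beta>: "0 < \<beta>" "\<beta> \<le> 2"
  shows "(1 / real (width \<beta> n)) powr \<beta> \<le> 4 * eps_star \<beta> n"
    and "real (width \<beta> n) \<le> 2 * (real n * (eps_star \<beta> n)\<^sup>2)"
    and "real n powr (1 / 5) \<le> real n * (eps_star \<beta> n)\<^sup>2"
proof -
  let ?K = "real (width \<beta> n)" and ?b = "1 / (2 * \<beta> + 1)"
  have K: "0 < ?K" by (simp add: width_pos)
  have "real n powr ?b / 2 \<le> ?K" using n \<beta> by (intro width_bounds) auto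
  then have "1 / ?K \<le> 2 * real n powr (- ?b)"
    using K n by (simp add: powr_minus field_simps)
  then have "(1 / ?K) powr \<beta> \<le> (2 * real n powr (- ?b)) powr \<beta>"
    using \<beta> K by (intro powr_mono2) auto
  also have "\<dots> = 2 powr \<beta> * eps_star \<beta> n"
    using \<beta> by (simp add: powr_mult powr_powr eps_star_def field_simps)
  also have "\<dots> \<le> 2 powr 2 * eps_star \<beta> n"
    using \<beta> by (intro mult_right_mono powr_mono) (auto simp: eps_star_def)
  finally show "(1 / ?K) powr \<beta> \<le> 4 * eps_star \<beta> n" by simp
  have *: "real n * (eps_star \<beta> n)\<^sup>2 = real n powr ?b"
  proof -
    let ?a = "- \<beta> / (1 + 2 * \<beta>)"
    have "real n * (eps_star \<beta> n)\<^sup>2 = real n powr 1 * (real n powr ?a * real n powr ?a)"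
      using n by (simp add: eps_star_def power2_eq_square)
    also have "\<dots> = real n powr (1 + (?a + ?a))"
      by (simp only: powr_add)
    finally have eq: "real n * (eps_star \<beta> n)\<^sup>2 = real n powr (1 + (?a + ?a))" .
    have "1 + (- \<beta> / d + - \<beta> / d) = (d - 2 * \<beta>) / d" if "d \<noteq> 0" for d
      using that by (simp add: field_simps)
    then have "1 + (?a + ?a) = ?b" using \<beta> by (simp add: add.commute)
    with eq show ?thesis by (simp only:)
  qed
  show "?K \<le> 2 * (real n * (eps_star \<beta> n)\<^sup>2)"
    unfolding * using n \<beta> by (intro width_bounds) auto
  show "real n powr (1 / 5) \<le> real n * (eps_star \<beta> n)\<^sup>2"
    unfolding * using n \<beta> by (intro powr_mono) (auto intro!: divide_left_mono)
qed

text \<open>Common form for both scalings. \<open>rate\<close> covers interpolation, coarse width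
  and bias; \<open>spread\<close> makes the tolerance per weight, in units of
  \<open>\<sigma>\<close>, exceed the logarithmic tail threshold; \<open>size\<close> bounds the
  cost of the coarse weights by the order of \<open>n * (\<epsilon> n)\<^sup>2\<close>.\<close>

theorem posterior_contraction:
  fixes \<alpha> \<beta> L F p q \<rho> C :: real and h g :: "real \<Rightarrow> real" and \<sigma> \<epsilon> :: "nat \<Rightarrow> real"
  assumes \<beta>: "0 < \<beta>" "\<beta> \<le> 2" and L: "0 < L" and F: "0 < F"
    and \<alpha>: "0 \<le> \<alpha>" "\<alpha> \<le> \<beta>" and \<rho>: "0 < \<rho>" "\<rho> < 1"
    and PX: "design_distribution PX" and p: "0 < p" "p \<le> 1"
    and h: "prob_density h" "p_exponential_tails p q h"
    and g: "prob_density g" "continuous_on UNIV g" "\<forall>t. 0 < g t"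
    and C: "1 \<le> C"
    and \<sigma>: "\<forall>\<^sub>F n in sequentially. 0 < \<sigma> n"
    and rate: "\<forall>\<^sub>F n in sequentially. eps_star \<beta> n \<le> C * \<epsilon> n"
    and spread: "\<forall>\<^sub>F n in sequentially. real (width \<alpha> n) * \<sigma> n * ln (real n) powr (1 / q) \<le> C * \<epsilon> n"
    and size: "\<forall>\<^sub>F n in sequentially.
      real (width \<beta> n) powr (1 + p * (1 - \<beta>)) * \<sigma> n powr (- p) \<le> C * (real n * (\<epsilon> n)\<^sup>2)"
  shows "\<exists>M\<^sub>0>0. \<forall>M'\<ge>M\<^sub>0. \<forall>f\<^sub>0\<in>holder_ball \<beta> L. (\<forall>x\<in>{0..1}. \<bar>f\<^sub>0 x\<bar> \<le> F) \<longrightarrow>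
     (\<lambda>n. \<integral>XY. clipped_rho_posterior \<rho> F (relu_prior (width \<alpha> n) (\<sigma> n) h g) n XY
                {f \<in> space C01. L2_dist PX f f\<^sub>0 \<ge> M' * \<epsilon> n}
              \<partial>sample_law PX f\<^sub>0 n) \<longlonglongrightarrow> 0"
proof -
  obtain B \<kappa> x\<^sub>0 where B: "0 < B" and \<kappa>: "0 < \<kappa>" and x0: "1 \<le> x\<^sub>0"
    and ball: "\<And>u. exp (- B - B * \<bar>u\<bar> powr p) \<le> measure (density lborel (\<lambda>t. ennreal (h t))) {u - 1..u + 1}"
    and center: "\<And>x \<tau>. x\<^sub>0 \<le> x \<Longrightarrow> \<kappa> * ln x powr (1 / q) \<le> \<tau> \<Longrightarrow>
      1 - 1 / x \<le> measure (density lborel (\<lambda>t. ennreal (h t))) {- \<tau>..\<tau>}"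
    using weight_small_ball[OF h p] by metis
  obtain \<gamma> where \<gamma>: "0 < \<gamma>" and bias: "\<And>b e. \<bar>b\<bar> \<le> F \<Longrightarrow> 0 < e \<Longrightarrow> e \<le> 1 \<Longrightarrow>
      \<gamma> * e \<le> measure (density lborel (\<lambda>t. ennreal (g t))) {b - e..b + e}"
    using bias_small_ball[OF g] by metis
  have q: "0 < q" using h(2) by (simp add: p_exponential_tails_def)
  \<comment> \<open>Uniform error in units of \<open>\<epsilon> n\<close>: interpolation, weights,
    bias.\<close>
  define D where "D = 4 * L * C + \<kappa> * C + C"
  \<comment> \<open>Bounds the negative log prior mass in units of
    \<open>n * (\<epsilon> n)\<^sup>2\<close>: constants and logarithms, number of coarse knots,
    size of the coarse weights.\<close>
  define C\<^sub>2 where "C\<^sub>2 = C\<^sup>2 + 2 * B * C\<^sup>2 + B * (4 * (2 * L) powr p * C)"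
  \<comment> \<open>The final 1 leaves a surplus \<open>- T\<close> in the exponent, which drives
    the posterior mass to 0. The radius \<open>M\<^sub>0\<close> solves
    \<open>clip_rate \<rho> F * M\<^sub>0\<^sup>2 = c\<close>.\<close>
  define c where "c = C\<^sub>2 + \<rho> * (1 + \<rho>) / 2 * D\<^sup>2 + 1"
  have c: "0 < c" unfolding c_def C\<^sub>2_def using C B \<rho> by (intro add_nonneg_pos add_nonneg_nonneg mult_nonneg_nonneg) auto
  have r: "0 < clip_rate \<rho> F" by (rule clip_rate_pos[OF \<rho>])
  define M\<^sub>0 where "M\<^sub>0 = sqrt (c / clip_rate \<rho> F)"
  have M0: "0 < M\<^sub>0" using c r by (simp add: M\<^sub>0_def)
  have ev1: "\<forall>\<^sub>F n in sequentially. 1 \<le> \<kappa> * ln (real n) powr (1 / q)"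
    using \<kappa> q by real_asymp
  \<comment> \<open>The 4 bounds \<open>2 * N / n\<close> for the off-grid weights, the rest is the
    cost of a bias window of radius \<open>n powr (- 1 / 2)\<close>. The right side is at most
    \<open>C\<^sup>2 * T\<close>, so these terms do not affect the rate.\<close>
  have ev2: "\<forall>\<^sub>F n in sequentially. 4 + ln (real n) / 2 - ln \<gamma> \<le> real n powr (1 / 5)"
    by real_asymp
  have ev3: "\<forall>\<^sub>F n in sequentially. x\<^sub>0 \<le> real n" by real_asymp
  have ev4: "\<forall>\<^sub>F n in sequentially. 2 \<le> n" by (rule eventually_ge_at_top)
  have "\<forall>\<^sub>F n in sequentially. \<forall>M'\<ge>M\<^sub>0. \<forall>f\<^sub>0\<in>holder_ball \<beta> L. (\<forall>x\<in>{0..1}. \<bar>f\<^sub>0 x\<bar> \<le> F) \<longrightarrow>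
     (\<integral>XY. clipped_rho_posterior \<rho> F (relu_prior (width \<alpha> n) (\<sigma> n) h g) n XY
                {f \<in> space C01. L2_dist PX f f\<^sub>0 \<ge> M' * \<epsilon> n}
              \<partial>sample_law PX f\<^sub>0 n) \<le> exp (- (real n powr (1 / 5) / (2 * C\<^sup>2)))"
    using \<sigma> rate spread size ev1 ev2 ev3 ev4
  proof (eventually_elim, intro allI impI ballI)
    fix n M' f\<^sub>0
    assume \<sigma>: "0 < \<sigma> n" and rate: "eps_star \<beta> n \<le> C * \<epsilon> n"
      and spread: "real (width \<alpha> n) * \<sigma> n * ln (real n) powr (1 / q) \<le> C * \<epsilon> n"
      and size: "real (width \<beta> n) powr (1 + p * (1 - \<beta>)) * \<sigma> n powr (- p) \<le> C * (real n * (\<epsilon> n)\<^sup>2)"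
      and n1: "1 \<le> \<kappa> * ln (real n) powr (1 / q)"
      and n2: "4 + ln (real n) / 2 - ln \<gamma> \<le> real n powr (1 / 5)"
      and n3: "x\<^sub>0 \<le> real n" and n4: "2 \<le> n"
      and M': "M\<^sub>0 \<le> M'" and f0: "f\<^sub>0 \<in> holder_ball \<beta> L" and f0F: "\<forall>x\<in>{0..1}. \<bar>f\<^sub>0 x\<bar> \<le> F"
    let ?N = "width \<alpha> n" and ?K = "width \<beta> n"
    have n: "1 \<le> n" using n4 by simp
    define m where "m = ?N div ?K"
    have N: "?N = m * ?K" using width_dvd[OF \<alpha> n] by (simp add: m_def)
    have m: "0 < m" using width_pos[of \<alpha> n] unfolding N by simp
    have N0: "0 < real ?N" by (simp add: width_pos)
    have star: "0 < eps_star \<beta> n" using n by (simp add: eps_star_def)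
    have \<epsilon>: "0 < \<epsilon> n" using less_le_trans[OF star rate] C by (simp add: zero_less_mult_iff)
    define T where "T = real n * (\<epsilon> n)\<^sup>2"
    have star_T: "real n * (eps_star \<beta> n)\<^sup>2 \<le> C\<^sup>2 * T"
    proof -
      have "(eps_star \<beta> n)\<^sup>2 \<le> (C * \<epsilon> n)\<^sup>2" using rate star by (intro power_mono) auto
      then have "real n * (eps_star \<beta> n)\<^sup>2 \<le> real n * (C * \<epsilon> n)\<^sup>2" by (rule mult_left_mono) simp
      then show ?thesis by (simp add: T_def power_mult_distrib mult_ac)
    qed
    have n5: "real n powr (1 / 5) \<le> C\<^sup>2 * T" using eps_star_width(3)[OF n \<beta>] star_T by linarith
    \<comment> \<open>Chosen so that all weight errors together amount to
      \<open>\<kappa> * C * \<epsilon> n\<close>; \<open>spread\<close> then says that the window is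
      wide enough for \<open>center\<close>.\<close>
    define \<tau> where "\<tau> = \<kappa> * C * \<epsilon> n / (real ?N * \<sigma> n)"
    have \<tau>_ge: "\<kappa> * ln (real n) powr (1 / q) \<le> \<tau>"
    proof -
      have "\<kappa> * (real ?N * \<sigma> n * ln (real n) powr (1 / q)) \<le> \<kappa> * (C * \<epsilon> n)"
        using spread \<kappa> by (intro mult_left_mono) auto
      then show ?thesis using N0 \<sigma> by (simp add: \<tau>_def field_simps)
    qed
    have \<tau>1: "1 \<le> \<tau>" using n1 \<tau>_ge by linarith
    \<comment> \<open>This radius is below \<open>eps_star\<close> for every smoothness and costs
      only a logarithm.\<close>
    define e where "e = real n powr (- 1 / 2)"
    have e: "0 < e" "e \<le> 1"
      using n powr_mono[of "- 1 / 2" 0 "real n"] by (auto simp: e_def)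
    have e_rate: "e \<le> eps_star \<beta> n"
      unfolding e_def eps_star_def using n \<beta> by (intro powr_mono) (auto simp: field_simps)
    define A where "A = (\<Pi>\<^sub>E k\<in>{..<m * ?K}. {embed_weight f\<^sub>0 ?K m k / \<sigma> n - \<tau>..embed_weight f\<^sub>0 ?K m k / \<sigma> n + \<tau>})
        \<times> {f\<^sub>0 0 - e..f\<^sub>0 0 + e}"
    define S where "S = (\<Sum>j<?K. \<bar>interp_weight f\<^sub>0 ?K j / \<sigma> n\<bar> powr p)"
    define V where "V = 2 * real ?N / real n + real ?K * B + B * S - ln (\<gamma> * e)"
    have A: "A \<in> sets (net_param ?N h g)"
      unfolding A_def N by (rule measure_net_param_box(1)[OF h(1) g(1)]) auto
    have mass: "exp (- V) \<le> measure (net_param ?N h g) A"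
    proof -
      have "exp (- V) = exp (- (2 * real (m * ?K) / real n + real ?K * B + B * S)) * (\<gamma> * e)"
        using \<gamma> e by (simp add: V_def N exp_diff exp_add exp_minus field_simps)
      also have "\<dots> \<le> measure (net_param (m * ?K) h g) A"
        unfolding A_def S_def using \<gamma> e n4 f0F
        by (intro prior_mass h(1) g(1) m \<tau>1 B ball center[OF n3 \<tau>_ge] bias) auto
      finally show ?thesis unfolding N .
    qed
    have near: "\<bar>(case \<theta> of (\<zeta>, b) \<Rightarrow> relu_net ?N (\<lambda>k. \<sigma> n * \<zeta> k) b) x - f\<^sub>0 x\<bar> \<le> D * \<epsilon> n"
      if \<theta>: "\<theta> \<in> A" and x: "x \<in> {0..1}" for \<theta> x
    proof -
      obtain \<zeta> b where \<theta>_eq: "\<theta> = (\<zeta>, b)" by force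
      have "\<bar>relu_net (m * ?K) (\<lambda>k. \<sigma> n * \<zeta> k) b x - f\<^sub>0 x\<bar>
          \<le> L * (1 / real ?K) powr \<beta> + real (m * ?K) * (\<sigma> n * \<tau>) + e"
        using \<theta> unfolding A_def \<theta>_eq
        by (intro relu_net_near_on_box[OF f0 \<beta> L width_pos m \<sigma> x]) auto
      also have "real (m * ?K) * (\<sigma> n * \<tau>) = \<kappa> * C * \<epsilon> n"
        unfolding N[symmetric] using N0 \<sigma> by (simp add: \<tau>_def)
      also have "L * (1 / real ?K) powr \<beta> \<le> L * (4 * (C * \<epsilon> n))"
        using eps_star_width(1)[OF n \<beta>] rate L by (intro mult_left_mono) auto
      also have "e \<le> C * \<epsilon> n" using e_rate rate by linarith
      finally show ?thesis unfolding \<theta>_eq N by (simp add: D_def algebra_simps)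
    qed
    have V_le: "V \<le> C\<^sub>2 * T"
    proof -
      have "real ?N \<le> 2 * real n powr (1 / (2 * \<alpha> + 1))" using n \<alpha> by (intro width_bounds) auto
      also have "\<dots> \<le> 2 * real n powr 1" using n \<alpha> by (intro mult_left_mono powr_mono) auto
      finally have "2 * real ?N / real n \<le> 4" using n by (simp add: field_simps)
      moreover have "real ?K * B \<le> 2 * B * C\<^sup>2 * T"
      proof -
        have "real ?K * B \<le> (2 * (C\<^sup>2 * T)) * B"
          using eps_star_width(2)[OF n \<beta>] star_T B by (intro mult_right_mono) auto
        then show ?thesis by (simp add: mult_ac)
      qed
      moreover have "B * S \<le> B * (4 * (2 * L) powr p * C) * T"
      proof -
        have "S \<le> 4 * (2 * L) powr p * (real ?K powr (1 + p * (1 - \<beta>)) * \<sigma> n powr (- p))"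
          unfolding S_def by (rule interp_weight_powr_sum[OF f0 \<beta> L width_pos p \<sigma>])
        also have "\<dots> \<le> 4 * (2 * L) powr p * (C * T)"
          using size by (intro mult_left_mono) (auto simp: T_def)
        finally have "B * S \<le> B * (4 * (2 * L) powr p * (C * T))" using B by (intro mult_left_mono) auto
        then show ?thesis by (simp add: mult_ac)
      qed
      moreover have "- ln (\<gamma> * e) = ln (real n) / 2 - ln \<gamma>"
        using \<gamma> n by (simp add: e_def ln_mult ln_powr)
      ultimately have "V \<le> C\<^sup>2 * T + 2 * B * C\<^sup>2 * T + B * (4 * (2 * L) powr p * C) * T"
        using n2 n5 unfolding V_def by linarith
      then show ?thesis by (simp add: C\<^sub>2_def algebra_simps)
    qed
    have [measurable]: "f\<^sub>0 \<in> borel_measurable PX"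
    proof -
      have "f\<^sub>0 \<in> borel_measurable (restrict_space borel {0..1})"
        by (intro borel_measurable_continuous_on_restrict holder_ball_continuous[OF f0 \<beta>])
      then show ?thesis
        using PX measurable_cong_sets[of PX "restrict_space borel {0..1}" borel borel]
        by (auto simp: design_distribution_def)
    qed
    have M'0: "0 \<le> M'" using M0 M' by linarith
    have "(\<integral>XY. clipped_rho_posterior \<rho> F (relu_prior ?N (\<sigma> n) h g) n XY
        {f \<in> space C01. L2_dist PX f f\<^sub>0 \<ge> M' * \<epsilon> n} \<partial>sample_law PX f\<^sub>0 n)
      \<le> exp ((V + real n * (\<rho> * (1 + \<rho>) / 2 * (D * \<epsilon> n)\<^sup>2) - real n * (clip_rate \<rho> F * (M' * \<epsilon> n)\<^sup>2)) / 2)"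
      unfolding relu_prior_def
      using f0F \<epsilon> M'0
      by (intro clipped_posterior_bound[OF PX prob_space_net_param[OF h(1) g(1)] _ F _ \<rho>
            relu_net_jointly_measurable[OF PX] relu_net_measurable_C01 A mass near]) auto
    also have "\<dots> \<le> exp (- (real n powr (1 / 5) / (2 * C\<^sup>2)))"
    proof -
      have "c = clip_rate \<rho> F * M\<^sub>0\<^sup>2" using c r by (simp add: M\<^sub>0_def)
      also have "\<dots> \<le> clip_rate \<rho> F * M'\<^sup>2" using r M' M0 by (intro mult_left_mono power_mono) auto
      finally have "c * T \<le> clip_rate \<rho> F * M'\<^sup>2 * T" by (rule mult_right_mono) (simp add: T_def)
      moreover have "real n * (clip_rate \<rho> F * (M' * \<epsilon> n)\<^sup>2) = clip_rate \<rho> F * M'\<^sup>2 * T"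
        "real n * (\<rho> * (1 + \<rho>) / 2 * (D * \<epsilon> n)\<^sup>2) = \<rho> * (1 + \<rho>) / 2 * D\<^sup>2 * T"
        by (simp_all add: T_def power_mult_distrib)
      moreover have "c * T = C\<^sub>2 * T + \<rho> * (1 + \<rho>) / 2 * D\<^sup>2 * T + T" by (simp add: c_def distrib_right)
      ultimately have "V + real n * (\<rho> * (1 + \<rho>) / 2 * (D * \<epsilon> n)\<^sup>2) - real n * (clip_rate \<rho> F * (M' * \<epsilon> n)\<^sup>2) \<le> - T"
        using V_le by linarith
      moreover have "real n powr (1 / 5) / C\<^sup>2 \<le> T" using n5 C by (simp add: field_simps)
      moreover have "real n powr (1 / 5) / (2 * C\<^sup>2) = real n powr (1 / 5) / C\<^sup>2 / 2" by simp
      moreover have "X / 2 \<le> - Z" if "X \<le> - T" "Y \<le> T" "Z = Y / 2" for X Y Z :: real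
        using that by linarith
      ultimately show ?thesis unfolding exp_le_cancel_iff by blast
    qed
    finally show "(\<integral>XY. clipped_rho_posterior \<rho> F (relu_prior ?N (\<sigma> n) h g) n XY
        {f \<in> space C01. L2_dist PX f f\<^sub>0 \<ge> M' * \<epsilon> n} \<partial>sample_law PX f\<^sub>0 n)
      \<le> exp (- (real n powr (1 / 5) / (2 * C\<^sup>2)))" .
  qed
  note bound = this
  have C2: "0 < 2 * C\<^sup>2" using C by simp
  have lim: "(\<lambda>n. exp (- (real n powr (1 / 5) / (2 * C\<^sup>2)))) \<longlonglongrightarrow> 0"
    using C2 by real_asymp
  show ?thesis
  proof (intro exI[of _ M\<^sub>0] conjI allI impI ballI M0)
    fix M' f\<^sub>0 assume "M\<^sub>0 \<le> M'" "f\<^sub>0 \<in> holder_ball \<beta> L" "\<forall>x\<in>{0..1}. \<bar>f\<^sub>0 x\<bar> \<le> F"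
    then have le: "\<forall>\<^sub>F n in sequentially. (\<integral>XY. clipped_rho_posterior \<rho> F (relu_prior (width \<alpha> n) (\<sigma> n) h g) n XY
                {f \<in> space C01. L2_dist PX f f\<^sub>0 \<ge> M' * \<epsilon> n}
              \<partial>sample_law PX f\<^sub>0 n) \<le> exp (- (real n powr (1 / 5) / (2 * C\<^sup>2)))"
      by (intro eventually_mono[OF bound]) blast
    show "(\<lambda>n. \<integral>XY. clipped_rho_posterior \<rho> F (relu_prior (width \<alpha> n) (\<sigma> n) h g) n XY
                {f \<in> space C01. L2_dist PX f f\<^sub>0 \<ge> M' * \<epsilon> n}
              \<partial>sample_law PX f\<^sub>0 n) \<longlonglongrightarrow> 0"
      by (rule tendsto_sandwich[OF always_eventually le tendsto_const lim])
        (auto simp: clipped_rho_posterior_def rho_posterior_def set_lebesgue_integral_def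
          intro!: integral_nonneg_AE divide_nonneg_nonneg)
  qed
qed

text \<open>Write \<open>N\<close>, \<open>K\<close>, \<open>l\<close> for the widths and the
  logarithm, and \<open>r = p / (2 + p)\<close>. The oracle scaling balances the requirements:
  \<open>N * \<sigma> * l powr (1 / q)\<close> equals \<open>K powr - \<beta>\<close> times the
  inflation factor \<open>N powr r * K powr r * l powr (r / q)\<close>, and the weight cost equals
  \<open>K\<close> times its square.\<close>

lemma oracle_conditions:
  assumes \<beta>: "0 < \<beta>" "\<beta> \<le> 2" and \<alpha>: "0 \<le> \<alpha>" "\<alpha> \<le> \<beta>" and p: "0 < p" "p \<le> 1" and q: "0 < q"
    and n: "3 \<le> n"
  shows "0 < sigma_oracle \<alpha> \<beta> p q n"
    and "eps_star \<beta> n \<le> 8 * eps_oracle \<alpha> \<beta> p q n"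
    and "real (width \<alpha> n) * sigma_oracle \<alpha> \<beta> p q n * ln (real n) powr (1 / q) \<le> 8 * eps_oracle \<alpha> \<beta> p q n"
    and "real (width \<beta> n) powr (1 + p * (1 - \<beta>)) * sigma_oracle \<alpha> \<beta> p q n powr (- p)
      \<le> 8 * (real n * (eps_oracle \<alpha> \<beta> p q n)\<^sup>2)"
proof -
  define r where "r = p / (2 + p)"
  define N K l s where "N = real (width \<alpha> n)" and "K = real (width \<beta> n)" and "l = ln (real n)" and "s = eps_star \<beta> n"
  have "exp 1 \<le> real n" using exp_le n by (intro order_trans[OF exp_le]) simp
  then have l: "1 \<le> l" using n by (simp add: l_def ln_ge_iff)
  have "1 \<le> width \<alpha> n" "1 \<le> width \<beta> n" using width_pos[of \<alpha> n] width_pos[of \<beta> n] by linarith+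
  then have N: "1 \<le> N" and K: "1 \<le> K" by (simp_all add: N_def K_def)
  have s: "0 < s" using n by (simp add: s_def eps_star_def)
  have p2: "2 + p \<noteq> 0" using p by simp
  have r: "0 < r" using p by (simp add: r_def)
  have u: "- 2 / (2 + p) = r - 1" using p2 by (simp add: r_def field_simps)
  have w: "- 2 / (q * (2 + p)) = (r - 1) / q" using p2 q by (simp add: r_def field_simps)
  have w': "p / (q * (2 + p)) = r / q" by (simp add: r_def)
  \<comment> \<open>A rearrangement of \<open>r * (2 + p) = p\<close>; it turns the exponent
    \<open>(r - 1) * - p\<close> into \<open>2 * r\<close>.\<close>
  have pr: "p * r = p - 2 * r" using p2 by (simp add: r_def field_simps)
  have sigma: "sigma_oracle \<alpha> \<beta> p q n = N powr (r - 1) * K powr (r - \<beta>) * l powr ((r - 1) / q)"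
    unfolding sigma_oracle_def u w N_def K_def l_def r_def[symmetric] ..
  have eps: "eps_oracle \<alpha> \<beta> p q n = s * (N powr r * K powr r * l powr (r / q))"
    unfolding eps_oracle_def w' N_def K_def l_def s_def r_def[symmetric] by (simp add: powr_mult)
  show "0 < sigma_oracle \<alpha> \<beta> p q n" unfolding sigma using N K l by simp
  have ge1: "1 \<le> N powr r * K powr r * l powr (r / q)"
    using N K l r q by (intro mult_ge1_I ge_one_powr_ge_zero) auto
  have "s * 1 \<le> s * (N powr r * K powr r * l powr (r / q))" using ge1 s by (intro mult_left_mono) auto
  then show "eps_star \<beta> n \<le> 8 * eps_oracle \<alpha> \<beta> p q n"
    unfolding eps s_def[symmetric] using s by linarith
  have "N * sigma_oracle \<alpha> \<beta> p q n * l powr (1 / q)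
      = (N powr 1 * N powr (r - 1)) * K powr (r + - \<beta>) * (l powr ((r - 1) / q) * l powr (1 / q))"
    using N by (simp add: sigma)
  also have "\<dots> = K powr - \<beta> * (N powr r * K powr r * l powr (r / q))"
  proof -
    have "1 + (r - 1) = r" "(r - 1) / q + 1 / q = r / q" by (simp_all flip: add_divide_distrib)
    then show ?thesis unfolding powr_add[symmetric] by (simp only: powr_add mult_ac)
  qed
  also have "\<dots> \<le> 4 * s * (N powr r * K powr r * l powr (r / q))"
    using eps_star_width(1)[of n \<beta>] \<beta> n K ge1
    by (intro mult_right_mono) (auto simp: s_def K_def powr_minus powr_divide inverse_eq_divide)
  also have "\<dots> \<le> 8 * eps_oracle \<alpha> \<beta> p q n" using s ge1 by (simp add: eps)
  finally show "real (width \<alpha> n) * sigma_oracle \<alpha> \<beta> p q n * ln (real n) powr (1 / q) \<le> 8 * eps_oracle \<alpha> \<beta> p q n"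
    unfolding N_def l_def .
  have k: "(r - 1) * - p = r + r" using pr by (simp add: algebra_simps)
  have "(r - 1) / q * - p = ((r - 1) * - p) / q" by simp
  then have k': "(r - 1) / q * - p = r / q + r / q" unfolding k add_divide_distrib .
  have "1 + p * (1 - \<beta>) + (r - \<beta>) * - p = 1 + (r + r)" using pr by (simp add: algebra_simps)
  note e1 = k k' this
  have "K powr (1 + p * (1 - \<beta>)) * sigma_oracle \<alpha> \<beta> p q n powr (- p)
      = N powr ((r - 1) * - p) * K powr (1 + p * (1 - \<beta>) + (r - \<beta>) * - p) * l powr ((r - 1) / q * - p)"
    unfolding sigma by (simp only: powr_mult powr_powr powr_add mult_ac)
  also have "\<dots> = K * (N powr r * K powr r * l powr (r / q))\<^sup>2"
  proof -
    have "K powr 1 = K" using K by simp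
    then show ?thesis unfolding e1 by (simp only: powr_add power2_eq_square mult_ac)
  qed
  also have "\<dots> \<le> 2 * (real n * s\<^sup>2) * (N powr r * K powr r * l powr (r / q))\<^sup>2"
    using eps_star_width(2)[of n \<beta>] \<beta> n by (intro mult_right_mono) (auto simp: K_def s_def)
  also have "\<dots> \<le> 8 * (real n * (eps_oracle \<alpha> \<beta> p q n)\<^sup>2)"
    by (simp add: eps power_mult_distrib)
  finally show "real (width \<beta> n) powr (1 + p * (1 - \<beta>)) * sigma_oracle \<alpha> \<beta> p q n powr (- p)
      \<le> 8 * (real n * (eps_oracle \<alpha> \<beta> p q n)\<^sup>2)"
    unfolding K_def .
qed

text \<open>With \<open>a\<close> and \<open>b\<close> the exponents of the two widths,
  \<open>\<beta> * b = (1 - b) / 2\<close> reduces everything to comparing powers of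
  \<open>n\<close>. In the weight cost the exponents agree exactly, which explains the rate; the
  logarithm is absorbed by \<open>n powr (p / 5)\<close>.\<close>

lemma nonoracle_conditions:
  assumes \<beta>: "0 < \<beta>" "\<beta> \<le> 2" and \<alpha>: "0 \<le> \<alpha>" "\<alpha> \<le> \<beta>" and p: "0 < p" "p \<le> 1"
    and n: "1 \<le> n" and ln: "ln (real n) powr (1 / q) \<le> real n powr (p / 5)"
  shows "0 < sigma_nonoracle \<alpha> n"
    and "eps_star \<beta> n \<le> 8 * eps_nonoracle \<alpha> \<beta> p n"
    and "real (width \<alpha> n) * sigma_nonoracle \<alpha> n * ln (real n) powr (1 / q) \<le> 8 * eps_nonoracle \<alpha> \<beta> p n"
    and "real (width \<beta> n) powr (1 + p * (1 - \<beta>)) * sigma_nonoracle \<alpha> n powr (- p)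
      \<le> 8 * (real n * (eps_nonoracle \<alpha> \<beta> p n)\<^sup>2)"
proof -
  define a b where "a = 1 / (2 * \<alpha> + 1)" and "b = 1 / (2 * \<beta> + 1)"
  define N K where "N = real (width \<alpha> n)" and "K = real (width \<beta> n)"
  have N0: "0 < N" and K0: "0 < K" by (simp_all add: N_def K_def width_pos)
  have N: "N \<le> 2 * real n powr a" unfolding N_def a_def using n \<alpha> by (intro width_bounds) auto
  have K: "K \<le> 2 * real n powr b" unfolding K_def b_def using n \<beta> by (intro width_bounds) auto
  have b: "1 / 5 \<le> b" "b \<le> a" unfolding a_def b_def using \<alpha> \<beta> by (auto intro!: divide_left_mono)
  have \<beta>b: "\<beta> * b = (1 - b) / 2" using \<beta> by (simp add: b_def field_simps)
  have star: "- \<beta> / (1 + 2 * \<beta>) = (b - 1) / 2"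
    using \<beta>b by (simp add: b_def add.commute) 
  define \<theta> where "\<theta> = (1 - \<beta>) / (2 + 4 * \<beta>) + 1 / 5 + 1 / (2 + 4 * \<alpha>)"
  have \<theta>: "\<theta> = (3 * b - 1) / 4 + 1 / 5 + a / 2"
  proof -
    have "(1 - \<beta>) / (2 + 4 * \<beta>) = (b - \<beta> * b) / 2"
      using \<beta> by (simp add: b_def field_simps)
    moreover have "1 / (2 + 4 * \<alpha>) = a / 2" using \<alpha> by (simp add: a_def field_simps)
    ultimately have "\<theta> = (b - \<beta> * b) / 2 + 1 / 5 + a / 2" by (simp only: \<theta>_def)
    then show ?thesis using \<beta>b by (simp add: field_simps)
  qed
  \<comment> \<open>This follows from \<open>1 / 5 \<le> b \<le> a\<close>, with equality at
    \<open>\<alpha> = \<beta> = 2\<close>, and is the room needed for the logarithm.\<close>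
  have \<theta>_ge: "1 / 5 \<le> \<theta>" using b by (simp add: \<theta> field_simps)
  have eps: "eps_nonoracle \<alpha> \<beta> p n = real n powr ((b - 1) / 2 + p * \<theta>)"
    unfolding eps_nonoracle_def eps_star_def star \<theta>_def[symmetric] by (rule powr_add[symmetric])
  have sigma: "sigma_nonoracle \<alpha> n = real n powr (- 2 / 5) / N"
    by (simp add: sigma_nonoracle_def eps_plus_def N_def)
  show "0 < sigma_nonoracle \<alpha> n" using n N0 by (simp add: sigma)
  have "eps_star \<beta> n \<le> eps_nonoracle \<alpha> \<beta> p n"
    unfolding eps eps_star_def star using n p \<theta>_ge by (intro powr_mono) auto
  moreover have "0 < eps_nonoracle \<alpha> \<beta> p n" using n by (simp add: eps)
  ultimately show "eps_star \<beta> n \<le> 8 * eps_nonoracle \<alpha> \<beta> p n" by linarith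
  have "N * sigma_nonoracle \<alpha> n * ln (real n) powr (1 / q) \<le> real n powr (- 2 / 5) * real n powr (p / 5)"
    using N0 ln by (simp add: sigma mult_left_mono)
  also have "\<dots> = real n powr (- 2 / 5 + p * (1 / 5))" unfolding powr_add[symmetric] by simp
  also have "\<dots> \<le> eps_nonoracle \<alpha> \<beta> p n"
    unfolding eps using n b \<theta>_ge p by (intro powr_mono add_mono mult_left_mono) auto
  finally show "real (width \<alpha> n) * sigma_nonoracle \<alpha> n * ln (real n) powr (1 / q) \<le> 8 * eps_nonoracle \<alpha> \<beta> p n"
    using \<open>0 < eps_nonoracle \<alpha> \<beta> p n\<close> unfolding N_def by linarith
  \<comment> \<open>As \<open>x \<le> 2\<close> and \<open>p \<le> 1\<close>, the factors 2 of the
    width bounds contribute at most 4 and 2, hence the constant 8.\<close>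
  define x where "x = 1 + p * (1 - \<beta>)"
  have x: "0 \<le> x" "x \<le> 2"
  proof -
    have "p * (1 - \<beta>) \<le> p * 1" "p * (- 1) \<le> p * (1 - \<beta>)"
      using p \<beta> by (intro mult_left_mono; simp)+
    then show "0 \<le> x" "x \<le> 2" using p unfolding x_def by linarith+
  qed
  have "K powr x \<le> (2 * real n powr b) powr x" using K K0 x by (intro powr_mono2) auto
  also have "\<dots> = 2 powr x * real n powr (b * x)" by (simp add: powr_mult powr_powr)
  also have "\<dots> \<le> 2 powr 2 * real n powr (b * x)" using x by (intro mult_right_mono powr_mono) auto
  finally have Kx: "K powr x \<le> 4 * real n powr (b * x)" by simp
  have "N powr p \<le> (2 * real n powr a) powr p" using N N0 p by (intro powr_mono2) auto
  also have "\<dots> = 2 powr p * real n powr (a * p)" by (simp add: powr_mult powr_powr)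
  also have "\<dots> \<le> 2 powr 1 * real n powr (a * p)" using p by (intro mult_right_mono powr_mono) auto
  finally have Np: "N powr p \<le> 2 * real n powr (a * p)" by simp
  have "K powr x * sigma_nonoracle \<alpha> n powr (- p) = K powr x * (N powr p * real n powr (2 / 5 * p))"
  proof -
    have "sigma_nonoracle \<alpha> n powr (- p) = N powr p * real n powr (2 / 5 * p)"
    proof -
      have "- 2 / 5 * - p = 2 / 5 * p" by simp
      then show ?thesis unfolding sigma powr_divide powr_powr powr_minus[of N]
        by (simp only: divide_inverse inverse_inverse_eq mult.commute)
    qed
    then show ?thesis by simp
  qed
  also have "\<dots> \<le> (4 * real n powr (b * x)) * ((2 * real n powr (a * p)) * real n powr (2 / 5 * p))"
    using Kx Np by (intro mult_mono) auto
  also have "\<dots> = 8 * real n powr (b * x + a * p + 2 / 5 * p)" by (simp add: powr_add)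
  also have "b * x + a * p + 2 / 5 * p = 1 + (((b - 1) / 2 + p * \<theta>) + ((b - 1) / 2 + p * \<theta>))"
  proof -
    have "b * x = b + p * (b - \<beta> * b)" by (simp add: x_def algebra_simps)
    also have "b - \<beta> * b = (3 * b - 1) / 2" using \<beta>b by simp
    finally show ?thesis by (simp add: \<theta> field_simps)
  qed
  also have "real n powr \<dots> = real n * (eps_nonoracle \<alpha> \<beta> p n)\<^sup>2"
    using n by (simp only: powr_add eps power2_eq_square) simp
  finally show "real (width \<beta> n) powr (1 + p * (1 - \<beta>)) * sigma_nonoracle \<alpha> n powr (- p)
      \<le> 8 * (real n * (eps_nonoracle \<alpha> \<beta> p n)\<^sup>2)"
    unfolding K_def x_def .
qed

theorem corollary2:
  fixes \<alpha> \<beta> L F p q \<rho> :: real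
    and h g :: "real \<Rightarrow> real"
    and PX :: "real measure"
  assumes "0 < \<beta>" "\<beta> \<le> 2" "0 < L" "0 < F"
    and "0 \<le> \<alpha>" "\<alpha> \<le> \<beta>"
    and "0 < \<rho>" "\<rho> < 1"
    and "design_distribution PX"
    and "0 < p" "p \<le> 1"
    and "prob_density h" "p_exponential_tails p q h"
    and "prob_density g" "\<forall>t. g (- t) = g t" "continuous_on UNIV g" "\<forall>t. 0 < g t"
  shows "\<exists>M\<^sub>0>0. \<forall>M'\<ge>M\<^sub>0. \<forall>f\<^sub>0\<in>holder_ball \<beta> L. (\<forall>x\<in>{0..1}. \<bar>f\<^sub>0 x\<bar> \<le> F) \<longrightarrow>
     ((\<lambda>n. \<integral>XY. clipped_rho_posterior \<rho> F
                (relu_prior (width \<alpha> n) (sigma_oracle \<alpha> \<beta> p q n) h g) n XY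
                {f \<in> space C01. L2_dist PX f f\<^sub>0 \<ge> M' * eps_oracle \<alpha> \<beta> p q n}
              \<partial>sample_law PX f\<^sub>0 n) \<longlonglongrightarrow> 0) \<and>
     ((\<lambda>n. \<integral>XY. clipped_rho_posterior \<rho> F
                (relu_prior (width \<alpha> n) (sigma_nonoracle \<alpha> n) h g) n XY
                {f \<in> space C01. L2_dist PX f f\<^sub>0 \<ge> M' * eps_nonoracle \<alpha> \<beta> p n}
              \<partial>sample_law PX f\<^sub>0 n) \<longlonglongrightarrow> 0)"
proof -
  have q: "0 < q" using \<open>p_exponential_tails p q h\<close> by (simp add: p_exponential_tails_def)
  have oracle_rates: "\<forall>\<^sub>F n in sequentially. 0 < sigma_oracle \<alpha> \<beta> p q n"
    "\<forall>\<^sub>F n in sequentially. eps_star \<beta> n \<le> 8 * eps_oracle \<alpha> \<beta> p q n"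
    "\<forall>\<^sub>F n in sequentially. real (width \<alpha> n) * sigma_oracle \<alpha> \<beta> p q n * ln (real n) powr (1 / q) \<le> 8 * eps_oracle \<alpha> \<beta> p q n"
    "\<forall>\<^sub>F n in sequentially. real (width \<beta> n) powr (1 + p * (1 - \<beta>)) * sigma_oracle \<alpha> \<beta> p q n powr (- p)
      \<le> 8 * (real n * (eps_oracle \<alpha> \<beta> p q n)\<^sup>2)"
    by (rule eventually_mono[OF eventually_ge_at_top[of 3]], intro oracle_conditions assms q; assumption)+
  have "\<exists>M\<^sub>0>0. \<forall>M'\<ge>M\<^sub>0. \<forall>f\<^sub>0\<in>holder_ball \<beta> L. (\<forall>x\<in>{0..1}. \<bar>f\<^sub>0 x\<bar> \<le> F) \<longrightarrow>
     (\<lambda>n. \<integral>XY. clipped_rho_posterior \<rho> F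
                (relu_prior (width \<alpha> n) (sigma_oracle \<alpha> \<beta> p q n) h g) n XY
                {f \<in> space C01. L2_dist PX f f\<^sub>0 \<ge> M' * eps_oracle \<alpha> \<beta> p q n}
              \<partial>sample_law PX f\<^sub>0 n) \<longlonglongrightarrow> 0"
    by (rule posterior_contraction[where q = q and C = 8 and \<sigma> = "sigma_oracle \<alpha> \<beta> p q" and \<epsilon> = "eps_oracle \<alpha> \<beta> p q"])
      (fact assms oracle_rates | simp)+
  then obtain M\<^sub>1 where M1: "0 < M\<^sub>1" "\<And>M' f\<^sub>0. M\<^sub>1 \<le> M' \<Longrightarrow> f\<^sub>0 \<in> holder_ball \<beta> L \<Longrightarrow> \<forall>x\<in>{0..1}. \<bar>f\<^sub>0 x\<bar> \<le> F \<Longrightarrow>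
     (\<lambda>n. \<integral>XY. clipped_rho_posterior \<rho> F
                (relu_prior (width \<alpha> n) (sigma_oracle \<alpha> \<beta> p q n) h g) n XY
                {f \<in> space C01. L2_dist PX f f\<^sub>0 \<ge> M' * eps_oracle \<alpha> \<beta> p q n}
              \<partial>sample_law PX f\<^sub>0 n) \<longlonglongrightarrow> 0"
    by blast
  have "\<forall>\<^sub>F n in sequentially. ln (real n) powr (1 / q) \<le> real n powr (p / 5)"
    using q \<open>0 < p\<close> by real_asymp
  with eventually_ge_at_top[of 1]
  have ev: "\<forall>\<^sub>F n in sequentially. 1 \<le> n \<and> ln (real n) powr (1 / q) \<le> real n powr (p / 5)"
    by eventually_elim simp
  have nonoracle_rates: "\<forall>\<^sub>F n in sequentially. 0 < sigma_nonoracle \<alpha> n"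
    "\<forall>\<^sub>F n in sequentially. eps_star \<beta> n \<le> 8 * eps_nonoracle \<alpha> \<beta> p n"
    "\<forall>\<^sub>F n in sequentially. real (width \<alpha> n) * sigma_nonoracle \<alpha> n * ln (real n) powr (1 / q) \<le> 8 * eps_nonoracle \<alpha> \<beta> p n"
    "\<forall>\<^sub>F n in sequentially. real (width \<beta> n) powr (1 + p * (1 - \<beta>)) * sigma_nonoracle \<alpha> n powr (- p)
      \<le> 8 * (real n * (eps_nonoracle \<alpha> \<beta> p n)\<^sup>2)"
    by (rule eventually_mono[OF ev], use nonoracle_conditions[OF assms(1,2,5,6,10,11), where q = q] in blast)+
  have "\<exists>M\<^sub>0>0. \<forall>M'\<ge>M\<^sub>0. \<forall>f\<^sub>0\<in>holder_ball \<beta> L. (\<forall>x\<in>{0..1}. \<bar>f\<^sub>0 x\<bar> \<le> F) \<longrightarrow>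
     (\<lambda>n. \<integral>XY. clipped_rho_posterior \<rho> F
                (relu_prior (width \<alpha> n) (sigma_nonoracle \<alpha> n) h g) n XY
                {f \<in> space C01. L2_dist PX f f\<^sub>0 \<ge> M' * eps_nonoracle \<alpha> \<beta> p n}
              \<partial>sample_law PX f\<^sub>0 n) \<longlonglongrightarrow> 0"
    by (rule posterior_contraction[where q = q and C = 8 and \<sigma> = "sigma_nonoracle \<alpha>" and \<epsilon> = "eps_nonoracle \<alpha> \<beta> p"])
      (fact assms nonoracle_rates | simp)+
  then obtain M\<^sub>2 where M2: "0 < M\<^sub>2" "\<And>M' f\<^sub>0. M\<^sub>2 \<le> M' \<Longrightarrow> f\<^sub>0 \<in> holder_ball \<beta> L \<Longrightarrow> \<forall>x\<in>{0..1}. \<bar>f\<^sub>0 x\<bar> \<le> F \<Longrightarrow>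
     (\<lambda>n. \<integral>XY. clipped_rho_posterior \<rho> F
                (relu_prior (width \<alpha> n) (sigma_nonoracle \<alpha> n) h g) n XY
                {f \<in> space C01. L2_dist PX f f\<^sub>0 \<ge> M' * eps_nonoracle \<alpha> \<beta> p n}
              \<partial>sample_law PX f\<^sub>0 n) \<longlonglongrightarrow> 0"
    by blast
  \<comment> \<open>One threshold has to serve both scalings, hence the larger of the two.\<close>
  show ?thesis
    by (intro exI[of _ "max M\<^sub>1 M\<^sub>2"] conjI allI impI ballI M1(2) M2(2)) (use M1(1) in auto)
qed

end
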